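(* Let $(X_i)_{i=1}^\infty$, $(Y_i)_{i=1}^\infty$ be independent random variables, all uniformly distributed on $[0,1]$. Then $$\lim_{n\to\infty}\frac{\mathbb{E}\big[\mathsf{M}^D_{1/2}((X_i)_{i=1}^n,(Y_i)_{i=1}^n)\big]-\mathbb{E}\big[\mathsf{M}_{1/2}((X_i)_{i=1}^n,(Y_i)_{i=1}^n)\big]}{\sqrt{n\log n}}=0$$ and $$\liminf_{n\to\infty}\frac{\mathbb{E}\big[\mathsf{M}^D_{1/2}((X_i)_{i=1}^n,(Y_i)_{i=1}^n)\big]}{\sqrt{n\log n}}>0.$$ In particular, if $I\subseteq\mathbb{R}$ is a bounded interval of positive length and $(X_i)_{i=1}^\infty$, $(Y_i)_{i=1}^\infty$ are instead independent and all uniformly distributed on $I$, then $$\liminf_{n\to\infty}\frac{\mathbb{E}\big[\mathsf{M}_{1/2}((X_i)_{i=1}^n,(Y_i)_{i=1}^n)\big]}{\sqrt{n\log n}}>0.$$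
   Context: For points $(x_i)_{i=1}^n,(y_i)_{i=1}^n\subseteq\mathbb{R}$, $\mathsf{M}_{1/2}((x_i)_{i=1}^n,(y_i)_{i=1}^n)=\min_{\sigma\in\mathcal{S}_n}\sum_{i=1}^n|x_i-y_{\sigma(i)}|^{1/2}$, with $\mathcal{S}_n$ the set of permutations of $\{1,\dots,n\}$. For points $(x_i)_{i=1}^n,(y_i)_{i=1}^n\subseteq(0,1)$, the boundary functional is $$\mathsf{M}^D_{1/2}((x_i)_{i=1}^n,(y_i)_{i=1}^n)=\inf\ \mathsf{M}_{1/2}\big((x_i)_{i=1}^n\cup(\tilde x_j)_{j=1}^m,\ (y_i)_{i=1}^n\cup(\tilde y_j)_{j=1}^m\big),$$ where the infimum runs over all integers $m\ge0$ and all families (repetitions allowed) of boundary points $(\tilde x_j)_{j=1}^m,(\tilde y_j)_{j=1}^m\subseteq\{0,1\}$; the unions denote concatenated families of $n+m$ points. *)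

theory Defs
  imports "HOL-Probability.Probability" "HOL-Combinatorics.Permutations"
begin

text \<open>A family of \<open>n\<close> real points is a function on \<open>nat\<close>, of which only the values
  at the indices \<open>0, \<dots>, n - 1\<close> matter.\<close>

definition matching_cost :: "nat \<Rightarrow> (nat \<Rightarrow> real) \<Rightarrow> (nat \<Rightarrow> real) \<Rightarrow> real" where
  "matching_cost n x y =
     Min ((\<lambda>\<sigma>. \<Sum>i<n. \<bar>x i - y (\<sigma> i)\<bar> powr (1/2)) ` {\<sigma>. \<sigma> permutes {..<n}})"

definition concat_family :: "nat \<Rightarrow> (nat \<Rightarrow> real) \<Rightarrow> (nat \<Rightarrow> real) \<Rightarrow> nat \<Rightarrow> real" where
  "concat_family n x x' = (\<lambda>i. if i < n then x i else x' (i - n))"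

definition boundary_matching_cost :: "nat \<Rightarrow> (nat \<Rightarrow> real) \<Rightarrow> (nat \<Rightarrow> real) \<Rightarrow> real" where
  "boundary_matching_cost n x y =
     Inf {matching_cost (n + m) (concat_family n x x') (concat_family n y y') | m x' y'.
            \<forall>j<m. x' j \<in> {0, 1} \<and> y' j \<in> {0, 1}}"

text \<open>Joint independence of all the \<open>X i\<close> and \<open>Y j\<close> together is independence of the
  single family indexed by \<open>nat + nat\<close>; it includes measurability of each of them.\<close>

definition indep_uniform_samples ::
    "'a measure \<Rightarrow> real set \<Rightarrow> (nat \<Rightarrow> 'a \<Rightarrow> real) \<Rightarrow> (nat \<Rightarrow> 'a \<Rightarrow> real) \<Rightarrow> bool" where
  "indep_uniform_samples M I X Y \<longleftrightarrow>
     prob_space M \<and>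
     prob_space.indep_vars M (\<lambda>_. borel) (case_sum X Y) UNIV \<and>
     (\<forall>i. distr M borel (X i) = uniform_measure lborel I) \<and>
     (\<forall>i. distr M borel (Y i) = uniform_measure lborel I)"

definition expected_matching_cost ::
    "'a measure \<Rightarrow> (nat \<Rightarrow> 'a \<Rightarrow> real) \<Rightarrow> (nat \<Rightarrow> 'a \<Rightarrow> real) \<Rightarrow> nat \<Rightarrow> real" where
  "expected_matching_cost M X Y n =
     (LINT \<omega>|M. matching_cost n (\<lambda>i. X i \<omega>) (\<lambda>i. Y i \<omega>))"

definition expected_boundary_matching_cost ::
    "'a measure \<Rightarrow> (nat \<Rightarrow> 'a \<Rightarrow> real) \<Rightarrow> (nat \<Rightarrow> 'a \<Rightarrow> real) \<Rightarrow> nat \<Rightarrow> real" where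
  "expected_boundary_matching_cost M X Y n =
     (LINT \<omega>|M. boundary_matching_cost n (\<lambda>i. X i \<omega>) (\<lambda>i. Y i \<omega>))"

end

theory Submission
  imports Defs "HOL-Real_Asymp.Real_Asymp"
begin

text \<open>
  \<^bold>\<open>Boundary versus no boundary.\<close> After cancelling coincident boundary points one may assume that \<open>F\<close>
  points at \<open>0\<close> are added on one side and \<open>F\<close> points at \<open>1\<close> on the other. By strict concavity of the
  square root an optimal matching is nested, so if \<open>F\<close> exceeds the discrepancy of the two samples, it
  contains an edge from \<open>0\<close> to \<open>1\<close>, which can be dropped. Hence the two costs differ by at most the
  discrepancy. Exponential moments bound the latter by \<open>O(\<surd>n)\<close> on a fixed grid of \<open>N\<close> points and
  by \<open>O(\<surd>(n ln n / N))\<close> inside its cells; then \<open>N\<close> tends to infinity.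

  \<^bold>\<open>Lower bound.\<close> The boundary cost dominates \<open>\<Sum>i. f (x i) - f (y i)\<close> for every \<open>f\<close> that is
  \<open>1/2\<close>-Hoelder with constant \<open>1\<close> and vanishes at \<open>0\<close> and \<open>1\<close>. Let \<open>f\<close> be a sum of tents of width \<open>4\<^sup>-\<^sup>k\<close>
  and height of order \<open>2\<^sup>-\<^sup>k\<close>, with signs chosen according to the samples. The tents of different
  scales do not interfere in the Hoelder seminorm, and each of the \<open>log\<^sub>4 n\<close> scales contributes
  order \<open>\<surd>n\<close> to the expectation.\<close>

section \<open>Couplings of finite families of points\<close>

definition family :: "nat \<Rightarrow> (nat \<Rightarrow> real) \<Rightarrow> real multiset" where
  "family n x = mset (map x [0..<n])"

text \<open>A matching as a multiset of edges: edges can be deleted and rerouted without tracking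
  indices or a permutation.\<close>

definition coupling :: "real multiset \<Rightarrow> real multiset \<Rightarrow> (real \<times> real) multiset \<Rightarrow> bool" where
  "coupling A B P \<longleftrightarrow> image_mset fst P = A \<and> image_mset snd P = B"

definition coupling_cost :: "(real \<times> real) multiset \<Rightarrow> real" where
  "coupling_cost P = (\<Sum>(a, b)\<in>#P. sqrt \<bar>a - b\<bar>)"

lemma family_concat: "family (n + m) (concat_family n x x') = family n x + family m x'"
proof -
  have "map (concat_family n x x') [0..<n + m]
      = map (concat_family n x x') [0..<n] @ map (concat_family n x x') [n..<n + m]"
    by (metis map_append upt_add_eq_append zero_le)
  also have "map (concat_family n x x') [0..<n] = map x [0..<n]"
    by (simp add: concat_family_def)
  also have "map (concat_family n x x') [n..<n + m] = map x' [0..<m]"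
    by (rule nth_equalityI) (auto simp: concat_family_def)
  finally show ?thesis
    by (simp add: family_def)
qed

lemma sum_family: "(\<Sum>a\<in>#family n x. f a) = (\<Sum>i<n. f (x i))"
  by (simp add: family_def flip: sum_mset_sum_list mset_map)
     (simp add: interv_sum_list_conv_sum_set_nat comp_def atLeast0LessThan sum_mset_sum_list
       del: mset_map)

lemma set_family: "set_mset (family n x) = x ` {..<n}"
  by (auto simp: family_def)

lemma size_family [simp]: "size (family n x) = n"
  by (simp add: family_def)

lemma coupling_cost_nonneg: "coupling_cost P \<ge> 0"
  unfolding coupling_cost_def by (induction P) auto

lemma coupling_cost_add [simp]:
  "coupling_cost (add_mset (a, b) P) = sqrt \<bar>a - b\<bar> + coupling_cost P"
  by (simp add: coupling_cost_def)

text \<open>List the edges so that their first coordinates read \<open>x 0, ..., x (n - 1)\<close>.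
  The second coordinates then form a rearrangement of the \<open>y i\<close>, which supplies the
  permutation \<open>\<sigma>\<close>.\<close>

lemma matching_cost_le_coupling_cost:
  assumes "coupling (family n x) (family n y) P"
  shows "matching_cost n x y \<le> coupling_cost P"
proof -
  obtain ps where ps: "mset ps = P"
    using ex_mset by blast
  have "mset (map x [0..<n]) = mset (map fst ps)"
    using assms ps by (auto simp: coupling_def family_def)
  then obtain p where p: "p permutes {..<length (map fst ps)}"
      and p_fst: "permute_list p (map fst ps) = map x [0..<n]"
    using mset_eq_permutation by blast
  define qs where "qs = permute_list p ps"
  have qs_fst: "map fst qs = map x [0..<n]"
    using p p_fst by (simp add: qs_def permute_list_map)
  have qs: "mset qs = P"
    using p ps by (simp add: qs_def)
  have "mset (map snd qs) = mset (map y [0..<n])"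
    using assms qs by (auto simp: coupling_def family_def)
  then obtain \<sigma> where \<sigma>: "\<sigma> permutes {..<n}"
      and \<sigma>_snd: "permute_list \<sigma> (map y [0..<n]) = map snd qs"
    using mset_eq_permutation by (metis diff_zero length_map length_upt)
  have len: "length qs = n"
    using qs_fst by (metis diff_zero length_map length_upt)
  have nth: "qs ! i = (x i, y (\<sigma> i))" if "i < n" for i
  proof -
    have "fst (qs ! i) = x i"
      using qs_fst len that by (metis add_0 diff_zero nth_map nth_map_upt)
    moreover have "snd (qs ! i) = y (\<sigma> i)"
      using permute_list_nth[of \<sigma> "map y [0..<n]" i] \<sigma> \<sigma>_snd len that
        permutes_in_image[OF \<sigma>, of i] by simp
    ultimately show ?thesis
      by (metis prod.collapse)
  qed
  have "coupling_cost P = (\<Sum>q\<leftarrow>qs. case q of (a, b) \<Rightarrow> sqrt \<bar>a - b\<bar>)"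
    unfolding coupling_cost_def qs[symmetric] by (metis mset_map sum_mset_sum_list)
  also have "\<dots> = (\<Sum>i<n. sqrt \<bar>x i - y (\<sigma> i)\<bar>)"
    by (simp add: sum_list_sum_nth len nth atLeast0LessThan)
  also have "\<dots> = (\<Sum>i<n. \<bar>x i - y (\<sigma> i)\<bar> powr (1/2))"
    by (simp add: powr_half_sqrt)
  also have "\<dots> \<ge> matching_cost n x y"
    unfolding matching_cost_def
    using \<sigma> by (intro Min_le finite_imageI finite_permutations) auto
  finally show ?thesis .
qed

text \<open>Together with \<open>matching_cost_le_coupling_cost\<close> this identifies the matching
  cost with a minimum over couplings, so the combinatorial arguments can work on multisets of
  edges.\<close>

lemma matching_cost_attained:
  obtains P where "coupling (family n x) (family n y) P" "coupling_cost P = matching_cost n x y"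
proof -
  let ?c = "\<lambda>\<sigma>. \<Sum>i<n. \<bar>x i - y (\<sigma> i)\<bar> powr (1/2)"
  have "matching_cost n x y \<in> ?c ` {\<sigma>. \<sigma> permutes {..<n}}"
    unfolding matching_cost_def
    by (rule Min_in) (auto intro!: finite_permutations permutes_id exI[of _ id])
  then obtain \<sigma> where \<sigma>: "\<sigma> permutes {..<n}" and eq: "matching_cost n x y = ?c \<sigma>"
    by auto
  define P where "P = image_mset (\<lambda>i. (x i, y (\<sigma> i))) (mset_set {..<n})"
  have family_eq: "family n z = image_mset z (mset_set {..<n})" for z
    by (simp add: family_def lessThan_atLeast0)
  have "image_mset snd P = image_mset y (image_mset \<sigma> (mset_set {..<n}))"
    by (simp add: P_def multiset.map_comp comp_def)
  also have "image_mset \<sigma> (mset_set {..<n}) = mset_set {..<n}"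
    using \<sigma> by (simp add: image_mset_mset_set permutes_inj_on permutes_image)
  finally have "coupling (family n x) (family n y) P"
    by (simp add: coupling_def family_eq P_def multiset.map_comp comp_def)
  moreover have "coupling_cost P = (\<Sum>i<n. sqrt \<bar>x i - y (\<sigma> i)\<bar>)"
    by (simp add: P_def coupling_cost_def multiset.map_comp comp_def sum_unfold_sum_mset)
  then have "coupling_cost P = matching_cost n x y"
    by (simp add: eq powr_half_sqrt)
  ultimately show thesis by (rule that)
qed

text \<open>All edges lie in the finite product of the supports and their number is fixed by
  \<open>A\<close>; this is what makes optimal couplings exist.\<close>

lemma finite_couplings: "finite {P. coupling A B P}"
proof (rule finite_subset)
  show "{P. coupling A B P} \<subseteq> {P. set_mset P \<subseteq> set_mset A \<times> set_mset B \<and> size P = size A}"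
  proof
    fix P assume "P \<in> {P. coupling A B P}"
    then have "A = image_mset fst P" "B = image_mset snd P"
      by (auto simp: coupling_def)
    then show "P \<in> {P. set_mset P \<subseteq> set_mset A \<times> set_mset B \<and> size P = size A}"
      by force
  qed
qed (use finite_multisets_of_size[of "set_mset A \<times> set_mset B"] in
      \<open>auto simp: multisets_of_size_def\<close>)

lemma optimal_coupling:
  assumes "coupling A B P"
  obtains Q where "coupling A B Q" "\<And>R. coupling A B R \<Longrightarrow> coupling_cost Q \<le> coupling_cost R"
proof -
  have "{P. coupling A B P} \<noteq> {}"
    using assms by auto
  from ex_min_if_finite[OF finite_imageI[OF finite_couplings], of coupling_cost A B] this
  obtain Q where "coupling A B Q" "\<not> (\<exists>R. coupling A B R \<and> coupling_cost R < coupling_cost Q)"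
    by auto
  then show thesis
    by (intro that[of Q]) (auto simp: not_less)
qed

section \<open>Rerouting edges: shortcuts and uncrossing\<close>

lemma sqrt_triangle: "sqrt \<bar>a - b\<bar> \<le> sqrt \<bar>a - c\<bar> + sqrt \<bar>c - (b::real)\<bar>"
proof -
  have "sqrt \<bar>a - b\<bar> \<le> sqrt (\<bar>a - c\<bar> + \<bar>c - b\<bar>)"
    by (simp add: abs_triangle_ineq)
  also have "\<dots> \<le> sqrt \<bar>a - c\<bar> + sqrt \<bar>c - b\<bar>"
    by (rule sqrt_add_le_add_sqrt) auto
  finally show ?thesis .
qed

text \<open>If \<open>c\<close> is joined to \<open>b\<close> and \<open>d\<close> to
  \<open>a\<close>, the detour from \<open>a\<close> over \<open>d\<close> and \<open>c\<close> to
  \<open>b\<close> bounds the length of the new edge \<open>(a, b)\<close>; only the middle leg from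
  \<open>d\<close> to \<open>c\<close> is an additional cost.\<close>

lemma coupling_shortcut:
  assumes "coupling (add_mset c A) (add_mset d B) P"
  obtains Q where "coupling A B Q" "coupling_cost Q \<le> coupling_cost P + sqrt \<bar>c - d\<bar>"
proof -
  have "c \<in># image_mset fst P"
    using assms by (auto simp: coupling_def)
  then obtain b where b: "(c, b) \<in># P"
    by auto
  then obtain P1 where P1: "P = add_mset (c, b) P1"
    by (metis multi_member_split)
  show thesis
  proof (cases "b = d")
    case True
    have "coupling A B P1"
      using assms P1 True by (auto simp: coupling_def)
    then show thesis
      by (rule that) (use P1 in simp)
  next
    case False
    have "d \<in># image_mset snd P"
      using assms by (auto simp: coupling_def)
    then have "d \<in># image_mset snd P1"
      using P1 False by auto
    then obtain a where "(a, d) \<in># P1"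
      by auto
    then obtain P2 where P2: "P1 = add_mset (a, d) P2"
      by (metis multi_member_split)
    have "coupling A B (add_mset (a, b) P2)"
      using assms unfolding P1 P2 coupling_def by auto
    moreover have "sqrt \<bar>a - b\<bar> \<le> sqrt \<bar>c - b\<bar> + sqrt \<bar>a - d\<bar> + sqrt \<bar>c - d\<bar>"
      using sqrt_triangle[of a b d] sqrt_triangle[of d b c] by (simp add: abs_minus_commute)
    ultimately show thesis
      by (intro that) (auto simp: P1 P2)
  qed
qed

text \<open>A common point is removed by \<open>coupling_shortcut\<close> with equal endpoints,
  which adds no cost.\<close>

lemma coupling_cancel:
  assumes "coupling (A + C) (B + C) P"
  obtains Q where "coupling A B Q" "coupling_cost Q \<le> coupling_cost P"
  using assms
proof (induction C arbitrary: P thesis)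
  case (add c C)
  have "coupling (add_mset c (A + C)) (add_mset c (B + C)) P"
    using add.prems(2) by simp
  then obtain Q where "coupling (A + C) (B + C) Q"
      and Q: "coupling_cost Q \<le> coupling_cost P + sqrt \<bar>c - c\<bar>"
    by (rule coupling_shortcut)
  from this(1) obtain R where "coupling A B R" "coupling_cost R \<le> coupling_cost Q"
    by (rule add.IH[rotated])
  with Q show thesis
    by (intro add.prems(1)[of R]) auto
qed auto

text \<open>After squaring, both sides contain \<open>b + p - a\<close>, and the products compare
  because \<open>a * p < a * b\<close>. Read on edges, the crossing pair \<open>(0, p)\<close>,
  \<open>(a, b)\<close> is dearer than the nested pair \<open>(0, b)\<close>,
  \<open>(a, p)\<close>.\<close>

lemma sqrt_uncross:
  assumes "0 < a" "a < p" "p < (b::real)"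
  shows "sqrt b + sqrt (p - a) < sqrt p + sqrt (b - a)"
proof (rule power2_less_imp_less)
  have "sqrt b * sqrt (p - a) < sqrt p * sqrt (b - a)"
    using assms by (simp add: algebra_simps flip: real_sqrt_mult)
  then show "(sqrt b + sqrt (p - a))\<^sup>2 < (sqrt p + sqrt (b - a))\<^sup>2"
    using assms by (simp add: power2_sum)
qed (use assms in auto)

text \<open>In an optimal coupling an edge leaving \<open>0\<close> cannot be crossed from the inside. Hence
  below the farthest partner \<open>p\<close> of \<open>0\<close> every point of \<open>A\<close> is coupled within \<open>[0, p]\<close>,
  and counting bounds the number of edges leaving \<open>0\<close>, unless one of them reaches \<open>1\<close>.\<close>

lemma crossing_edge_exists:
  assumes A: "set_mset A \<subseteq> {0<..<1}" and B: "set_mset B \<subseteq> {0<..<1}"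
    and disc: "\<And>t. 0 < t \<Longrightarrow> t < 1 \<Longrightarrow> size {#b\<in>#B. b \<le> t#} - real (size {#a\<in>#A. a < t#}) < real F"
    and F: "0 < F"
    and P: "coupling (A + replicate_mset F 0) (B + replicate_mset F 1) P"
    and opt: "\<And>Q. coupling (A + replicate_mset F 0) (B + replicate_mset F 1) Q \<Longrightarrow>
      coupling_cost P \<le> coupling_cost Q"
  shows "(0, 1) \<in># P"
proof (rule ccontr)
  assume no: "(0, 1) \<notin># P"
  have fstP: "image_mset fst P = A + replicate_mset F 0"
    and sndP: "image_mset snd P = B + replicate_mset F 1"
    using P by (auto simp: coupling_def)
  have fst_mem: "a \<in># A \<or> a = 0" if "(a, b) \<in># P" for a b
  proof -
    have "a \<in># image_mset fst P" using that by force
    then show ?thesis unfolding fstP by (auto split: if_splits)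
  qed
  have snd_mem: "b \<in># B \<or> b = 1" if "(a, b) \<in># P" for a b
  proof -
    have "b \<in># image_mset snd P" using that by force
    then show ?thesis unfolding sndP by (auto split: if_splits)
  qed
  define S where "S = {b. (0, b) \<in># P}"
  have "S \<subseteq> snd ` set_mset P" by (force simp: S_def)
  then have finS: "finite S" by (rule finite_subset) auto
  have "0 \<in># image_mset fst P" unfolding fstP using F by auto
  then have neS: "S \<noteq> {}" by (auto simp: S_def)
  define p where "p = Max S"
  have pS: "(0, p) \<in># P"
    using Max_in[OF finS neS] by (simp add: p_def S_def)
  then have p: "0 < p" "p < 1"
    using snd_mem[OF pS] no B by auto
  have inside: "b \<le> p" if ab: "(a, b) \<in># P" "a < p" for a b
  proof (rule ccontr)
    assume "\<not> b \<le> p"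
    then have b: "p < b" by simp
    have "a \<noteq> 0"
      using Max_ge[OF finS, of b] ab b by (auto simp: p_def S_def)
    then have a: "0 < a"
      using fst_mem[OF ab(1)] A by auto
    obtain P1 where P1: "P = add_mset (0, p) P1"
      using pS by (metis multi_member_split)
    have "(a, b) \<in># P1"
      using ab P1 a by auto
    then obtain P2 where P2: "P1 = add_mset (a, b) P2"
      by (metis multi_member_split)
    have "coupling (A + replicate_mset F 0) (B + replicate_mset F 1)
        (add_mset (0, b) (add_mset (a, p) P2))"
      using P unfolding P1 P2 coupling_def by (simp add: add_mset_commute)
    from opt[OF this] have "sqrt p + sqrt (b - a) \<le> sqrt b + sqrt (p - a)"
      using a b ab p by (simp add: P1 P2 abs_minus_commute)
    with sqrt_uncross[OF a ab(2) b] show False by simp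
  qed
  have filter_rep: "filter_mset R (replicate_mset k z) = (if R z then replicate_mset k z else {#})"
    for R and k :: nat and z :: real
    by (induction k) auto
  \<comment> \<open>The edges starting below \<open>p\<close> are the \<open>F\<close> edges from
    \<open>0\<close> and those from points of \<open>A\<close> below \<open>p\<close>. All of them
    end at or below \<open>p\<close>, hence in \<open>B\<close>, since the copies of
    \<open>1\<close> lie beyond \<open>p\<close>. This count contradicts \<open>disc\<close> at
    \<open>p\<close>.\<close>
  have "F + size {#a\<in>#A. a < p#} = size {#a\<in>#image_mset fst P. a < p#}"
    using p by (simp add: fstP filter_rep)
  also have "\<dots> = size {#q\<in>#P. fst q < p#}"
    by (simp add: filter_mset_image_mset)
  also have "\<dots> \<le> size {#q\<in>#P. snd q \<le> p#}"
  proof -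
    have "size {#q\<in>#M. fst q < p#} \<le> size {#q\<in>#M. snd q \<le> p#}"
      if "\<forall>(a, b)\<in>#M. a < p \<longrightarrow> b \<le> p" for M
      using that by (induction M) (auto simp: le_SucI)
    then show ?thesis using inside by blast
  qed
  also have "\<dots> = size {#b\<in>#image_mset snd P. b \<le> p#}"
    by (simp add: filter_mset_image_mset)
  also have "\<dots> = size {#b\<in>#B. b \<le> p#}"
    using p by (simp add: sndP filter_rep)
  finally show False
    using disc[OF p] by linarith
qed

text \<open>Induction on \<open>F\<close>. As long as \<open>F\<close> exceeds \<open>K\<close>, an
  optimal coupling contains an edge from \<open>0\<close> to \<open>1\<close>, and dropping it only
  lowers the cost. Once \<open>F\<close> is at most \<open>K\<close>, each remaining pair is removed
  by a shortcut of length \<open>1\<close>.\<close>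

lemma coupling_remove_flux:
  assumes A: "set_mset A \<subseteq> {0<..<1}" and B: "set_mset B \<subseteq> {0<..<1}" and K: "0 \<le> K"
    and disc: "\<And>t. 0 < t \<Longrightarrow> t < 1 \<Longrightarrow> size {#b\<in>#B. b \<le> t#} - real (size {#a\<in>#A. a < t#}) \<le> K"
    and P: "coupling (A + replicate_mset F 0) (B + replicate_mset F 1) P"
  obtains Q where "coupling A B Q" "coupling_cost Q \<le> coupling_cost P + min K F"
  using P
proof (induction F arbitrary: P thesis)
  case 0
  then show ?case using K by auto
next
  case (Suc F)
  show ?case
  proof (cases "real (Suc F) \<le> K")
    case True
    have "coupling (add_mset 0 (A + replicate_mset F 0)) (add_mset 1 (B + replicate_mset F 1)) P"
      using Suc.prems(2) by simp
    then obtain R where R: "coupling (A + replicate_mset F 0) (B + replicate_mset F 1) R"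
        "coupling_cost R \<le> coupling_cost P + sqrt \<bar>0 - 1\<bar>"
      by (rule coupling_shortcut)
    from Suc.IH[OF _ R(1)] obtain Q where
      "coupling A B Q" "coupling_cost Q \<le> coupling_cost R + min K F" by blast
    with True R(2) show thesis
      by (intro Suc.prems(1)) auto
  next
    case False
    from optimal_coupling[OF Suc.prems(2)] obtain R where
        R: "coupling (A + replicate_mset (Suc F) 0) (B + replicate_mset (Suc F) 1) R"
      and opt: "\<And>Q. coupling (A + replicate_mset (Suc F) 0) (B + replicate_mset (Suc F) 1) Q \<Longrightarrow>
          coupling_cost R \<le> coupling_cost Q" by blast
    have "(0, 1) \<in># R"
    proof (rule crossing_edge_exists[OF A B _ _ R opt])
      show "size {#b\<in>#B. b \<le> t#} - real (size {#a\<in>#A. a < t#}) < real (Suc F)"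
        if "0 < t" "t < 1" for t
        using disc[OF that] False by linarith
    qed auto
    then obtain R' where R': "R = add_mset (0, 1) R'"
      by (metis multi_member_split)
    then have "coupling (A + replicate_mset F 0) (B + replicate_mset F 1) R'"
      using R by (auto simp: coupling_def)
    from Suc.IH[OF _ this] obtain Q where
      "coupling A B Q" "coupling_cost Q \<le> coupling_cost R' + min K F" by blast
    with False R' opt[OF Suc.prems(2)] show thesis
      by (intro Suc.prems(1)) auto
  qed
qed

lemma coupling_swap:
  "coupling A B P \<Longrightarrow> coupling B A (image_mset prod.swap P)"
  by (auto simp: coupling_def multiset.map_comp comp_def)

lemma coupling_cost_swap: "coupling_cost (image_mset prod.swap P) = coupling_cost P"
  by (induction P) (auto simp: coupling_cost_def abs_minus_commute)

text \<open>Boundary points present on both sides cancel for free. As the two sides carry equally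
  many, what remains is \<open>F\<close> copies of one endpoint on one side and \<open>F\<close>
  copies of the other endpoint on the other side. The loss \<open>K\<close> does not depend on
  \<open>F\<close>.\<close>

lemma coupling_remove_boundary:
  assumes A: "set_mset A \<subseteq> {0<..<1}" and B: "set_mset B \<subseteq> {0<..<1}" and K: "0 \<le> K"
    and disc: "\<And>t. 0 < t \<Longrightarrow> t < 1 \<Longrightarrow> size {#b\<in>#B. b \<le> t#} - real (size {#a\<in>#A. a < t#}) \<le> K"
    and disc': "\<And>t. 0 < t \<Longrightarrow> t < 1 \<Longrightarrow> size {#a\<in>#A. a \<le> t#} - real (size {#b\<in>#B. b < t#}) \<le> K"
    and A': "set_mset A' \<subseteq> {0, 1}" and B': "set_mset B' \<subseteq> {0, 1}" and size: "size A' = size B'"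
    and P: "coupling (A + A') (B + B') P"
  obtains Q where "coupling A B Q" "coupling_cost Q \<le> coupling_cost P + K"
proof -
  have split: "C = replicate_mset (count C 0) 0 + replicate_mset (count C 1) (1::real)"
    if "set_mset C \<subseteq> {0, 1}" for C
    using that by (intro multiset_eqI) (auto simp: not_in_iff[symmetric])
  have size01: "size C = count C 0 + count C (1::real)" if "set_mset C \<subseteq> {0, 1}" for C
    using arg_cong[OF split[OF that], of size] by simp
  define a where "a = count A' 0" define b where "b = count A' 1"
  define c where "c = count B' 0" define d where "d = count B' 1"
  have sum: "a + b = c + d"
    using size01[OF A'] size01[OF B'] size by (simp add: a_def b_def c_def d_def)
  have rep: "replicate_mset (i + j) z = replicate_mset i z + replicate_mset j (z::real)" for i j z
    by (intro multiset_eqI) auto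
  show thesis
  proof (cases "c \<le> a")
    case True
    then obtain F where F: "a = c + F" "d = b + F"
      using sum by (metis add.commute add.left_commute add_left_cancel le_Suc_ex)
    define C where "C = replicate_mset c 0 + replicate_mset b (1::real)"
    have "A' = replicate_mset F 0 + C" "B' = replicate_mset F 1 + C"
      using split[OF A'] split[OF B'] F
      by (simp_all add: C_def rep ac_simps flip: a_def b_def c_def d_def)
    then have "coupling (A + replicate_mset F 0 + C) (B + replicate_mset F 1 + C) P"
      using P by (simp add: add.assoc)
    then obtain R where R: "coupling (A + replicate_mset F 0) (B + replicate_mset F 1) R"
        "coupling_cost R \<le> coupling_cost P"
      by (rule coupling_cancel)
    obtain Q where "coupling A B Q" "coupling_cost Q \<le> coupling_cost R + min K F"
      by (rule coupling_remove_flux[OF A B K disc R(1)])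
    with R(2) show thesis by (intro that) auto
  next
    case False
    then obtain F where F: "c = a + F" "b = d + F"
      using sum by (metis add.commute add.left_commute add_left_cancel le_Suc_ex nat_le_linear)
    define C where "C = replicate_mset a 0 + replicate_mset d (1::real)"
    have "A' = replicate_mset F 1 + C" "B' = replicate_mset F 0 + C"
      using split[OF A'] split[OF B'] F
      by (simp_all add: C_def rep ac_simps flip: a_def b_def c_def d_def)
    then have "coupling (A + replicate_mset F 1 + C) (B + replicate_mset F 0 + C) P"
      using P by (simp add: add.assoc)
    then obtain R where R: "coupling (A + replicate_mset F 1) (B + replicate_mset F 0) R"
        "coupling_cost R \<le> coupling_cost P"
      by (rule coupling_cancel)
    \<comment> \<open>Here the excess zeros are on the side of \<open>B\<close>. Exchanging the two
      sides restores the setting of \<open>coupling_remove_flux\<close>, with \<open>disc'\<close>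
      in place of \<open>disc\<close>.\<close>
    obtain Q where "coupling B A Q"
        "coupling_cost Q \<le> coupling_cost (image_mset prod.swap R) + min K F"
      by (rule coupling_remove_flux[OF B A K disc' coupling_swap[OF R(1)]])
    with R(2) show thesis
      by (intro that[of "image_mset prod.swap Q"]) (auto simp: coupling_swap coupling_cost_swap)
  qed
qed

section \<open>The boundary functional and its comparison with the matching cost\<close>

abbreviation boundary_costs :: "nat \<Rightarrow> (nat \<Rightarrow> real) \<Rightarrow> (nat \<Rightarrow> real) \<Rightarrow> real set" where
  "boundary_costs n x y \<equiv>
     {matching_cost (n + m) (concat_family n x x') (concat_family n y y') | m x' y'.
        \<forall>j<m. x' j \<in> {0, 1} \<and> y' j \<in> {0, 1}}"

lemma matching_cost_nonneg: "0 \<le> matching_cost n x y"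
  using matching_cost_attained coupling_cost_nonneg by metis

lemma matching_cost_cong:
  assumes "\<And>i. i < n \<Longrightarrow> x i = x' i" "\<And>i. i < n \<Longrightarrow> y i = y' i"
  shows "matching_cost n x y = matching_cost n x' y'"
proof -
  have "family n x = family n x'" "family n y = family n y'"
    unfolding family_def using assms by (auto intro!: image_mset_cong)
  then show ?thesis
    by (metis antisym matching_cost_attained matching_cost_le_coupling_cost)
qed

lemma bdd_below_boundary_costs: "bdd_below (boundary_costs n x y)"
  by (rule bdd_belowI[of _ 0]) (auto simp: matching_cost_nonneg)

lemma boundary_costs_nonempty: "boundary_costs n x y \<noteq> {}"
  by (auto intro: exI[of _ 0])

lemma boundary_le_matching_cost: "boundary_matching_cost n x y \<le> matching_cost n x y"
proof -
  have "matching_cost n x y = matching_cost n (concat_family n x x) (concat_family n y y)"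
    by (rule matching_cost_cong) (auto simp: concat_family_def)
  then have "matching_cost n x y \<in> boundary_costs n x y"
    by (force intro: exI[of _ 0])
  then show ?thesis
    unfolding boundary_matching_cost_def by (rule cInf_lower[OF _ bdd_below_boundary_costs])
qed

lemma boundary_matching_cost_nonneg: "0 \<le> boundary_matching_cost n x y"
  unfolding boundary_matching_cost_def
  by (rule cInf_greatest[OF boundary_costs_nonempty]) (auto simp: matching_cost_nonneg)

text \<open>Each competitor in the infimum loses at most \<open>K\<close> when its boundary points
  are removed, uniformly in their number \<open>m\<close>, so the estimate passes to the
  infimum.\<close>

lemma matching_cost_le_boundary:
  assumes x: "\<And>i. i < n \<Longrightarrow> x i \<in> {0<..<1}" and y: "\<And>i. i < n \<Longrightarrow> y i \<in> {0<..<1}" and K: "0 \<le> K"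
    and disc: "\<And>t. 0 < t \<Longrightarrow> t < 1 \<Longrightarrow>
      (\<Sum>i<n. indicator {..t} (y i)) - (\<Sum>i<n. indicator {..<t} (x i)) \<le> K"
    and disc': "\<And>t. 0 < t \<Longrightarrow> t < 1 \<Longrightarrow>
      (\<Sum>i<n. indicator {..t} (x i)) - (\<Sum>i<n. indicator {..<t} (y i)) \<le> K"
  shows "matching_cost n x y \<le> boundary_matching_cost n x y + K"
proof -
  have size: "real (size {#a\<in>#family n z. a \<in> S#}) = (\<Sum>i<n. indicator S (z i))" for z S
  proof -
    have "real (size {#a\<in>#M. a \<in> S#}) = (\<Sum>a\<in>#M. indicator S a)" for M :: "real multiset"
      by (induction M) (auto simp: indicator_def)
    then show ?thesis by (simp add: sum_family)
  qed
  have "matching_cost n x y - K \<le> boundary_matching_cost n x y"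
    unfolding boundary_matching_cost_def
  proof (rule cInf_greatest[OF boundary_costs_nonempty])
    fix c assume "c \<in> boundary_costs n x y"
    then obtain m x' y' where
      c: "c = matching_cost (n + m) (concat_family n x x') (concat_family n y y')"
      and b: "\<And>j. j < m \<Longrightarrow> x' j \<in> {0, 1} \<and> y' j \<in> {0, 1}" by auto
    obtain P where P: "coupling (family (n + m) (concat_family n x x'))
        (family (n + m) (concat_family n y y')) P" "coupling_cost P = c"
      unfolding c by (rule matching_cost_attained)
    obtain Q where Q: "coupling (family n x) (family n y) Q" "coupling_cost Q \<le> coupling_cost P + K"
    proof (rule coupling_remove_boundary[where A = "family n x" and B = "family n y" and K = K
          and A' = "family m x'" and B' = "family m y'" and P = P])
      show "real (size {#b \<in># family n y. b \<le> t#}) - real (size {#a \<in># family n x. a < t#}) \<le> K"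
        if "0 < t" "t < 1" for t
        using disc[OF that] size[where z=y and S="{..t}"] size[where z=x and S="{..<t}"] by simp
      show "real (size {#a \<in># family n x. a \<le> t#}) - real (size {#b \<in># family n y. b < t#}) \<le> K"
        if "0 < t" "t < 1" for t
        using disc'[OF that] size[where z=x and S="{..t}"] size[where z=y and S="{..<t}"] by simp
    qed (use x y K b P in \<open>auto simp: set_family family_concat\<close>)
    show "matching_cost n x y - K \<le> c"
      using matching_cost_le_coupling_cost[OF Q(1)] Q(2) P(2) by linarith
  qed
  then show ?thesis by simp
qed

text \<open>The easy half of Kantorovich duality: sum \<open>f a - f b\<close> over the edges of a
  coupling. The added boundary points contribute nothing because \<open>f\<close> vanishes at
  \<open>0\<close> and \<open>1\<close>.\<close>

lemma holder_le_boundary_matching_cost: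
  fixes f :: "real \<Rightarrow> real"
  assumes f: "\<And>s t. f s - f t \<le> sqrt \<bar>s - t\<bar>" and f01: "f 0 = 0" "f 1 = 0"
  shows "(\<Sum>i<n. f (x i) - f (y i)) \<le> boundary_matching_cost n x y"
  unfolding boundary_matching_cost_def
proof (rule cInf_greatest[OF boundary_costs_nonempty])
  fix c assume "c \<in> boundary_costs n x y"
  then obtain m x' y' where
    c: "c = matching_cost (n + m) (concat_family n x x') (concat_family n y y')"
    and b: "\<And>j. j < m \<Longrightarrow> x' j \<in> {0, 1} \<and> y' j \<in> {0, 1}" by auto
  obtain P where P: "coupling (family (n + m) (concat_family n x x'))
      (family (n + m) (concat_family n y y')) P" "coupling_cost P = c"
    unfolding c by (rule matching_cost_attained)
  have zero: "(\<Sum>j<m. f (x' j)) = 0" "(\<Sum>j<m. f (y' j)) = 0"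
    using b f01 by (intro sum.neutral; fastforce)+
  have "(\<Sum>i<n. f (x i) - f (y i))
      = (\<Sum>a\<in>#family n x + family m x'. f a) - (\<Sum>b\<in>#family n y + family m y'. f b)"
    by (simp add: sum_family zero sum_subtractf)
  also have "\<dots> = (\<Sum>a\<in>#image_mset fst P. f a) - (\<Sum>b\<in>#image_mset snd P. f b)"
    using P by (simp add: coupling_def family_concat)
  also have "\<dots> \<le> coupling_cost P"
  proof (induction P)
    case (add q P)
    then show ?case using f[of "fst q" "snd q"] by (cases q) auto
  qed (simp add: coupling_cost_def)
  finally show "(\<Sum>i<n. f (x i) - f (y i)) \<le> c" using P(2) by simp
qed

section \<open>Multiscale tent functions\<close>

definition tent :: "real \<Rightarrow> real" where
  "tent u = max 0 (min u (1 - u))"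

definition tents :: "nat \<Rightarrow> (nat \<Rightarrow> real) \<Rightarrow> real \<Rightarrow> real" where
  "tents m \<epsilon> u = (\<Sum>j<m. \<epsilon> j * tent (u - real j))"

text \<open>The amplitude \<open>(1/2) ^ k\<close> is the square root of the tent width at scale
  \<open>k\<close>, the scaling that fits the exponent \<open>1/2\<close>.\<close>

definition multiscale :: "nat \<Rightarrow> (nat \<Rightarrow> nat \<Rightarrow> real) \<Rightarrow> real \<Rightarrow> real" where
  "multiscale L \<epsilon> t = (\<Sum>k<L. (1/2) ^ k * tents (4 ^ k) (\<epsilon> k) (4 ^ k * t))"

lemma tent_bounds: "0 \<le> tent u" "tent u \<le> 1/2"
  by (auto simp: tent_def max_def min_def)

lemma tent_lipschitz: "\<bar>tent u - tent v\<bar> \<le> \<bar>u - v\<bar>"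
  by (auto simp: tent_def max_def min_def abs_if)

lemma tent_eq_0: "u \<le> 0 \<or> 1 \<le> u \<Longrightarrow> tent u = 0"
  by (auto simp: tent_def)

lemma tents_eq:
  "tents m \<epsilon> u = (if 0 \<le> u \<and> u < real m then \<epsilon> (nat \<lfloor>u\<rfloor>) * tent (u - \<lfloor>u\<rfloor>) else 0)"
proof -
  have zero: "tent (u - real j) = 0" if "int j \<noteq> \<lfloor>u\<rfloor>" for j
    by (rule tent_eq_0) (use that in linarith)
  show ?thesis
  proof (cases "0 \<le> u \<and> u < real m")
    case True
    then have "nat \<lfloor>u\<rfloor> \<in> {..<m}" by (auto simp: floor_less_iff nat_less_iff)
    then have "tents m \<epsilon> u = \<epsilon> (nat \<lfloor>u\<rfloor>) * tent (u - real (nat \<lfloor>u\<rfloor>))"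
      unfolding tents_def using True
      by (subst sum.remove[of _ "nat \<lfloor>u\<rfloor>"]) (auto intro!: sum.neutral zero)
    with True show ?thesis by simp
  next
    case False
    then have "tents m \<epsilon> u = 0"
      unfolding tents_def by (intro sum.neutral ballI) (auto simp: tent_eq_0)
    with False show ?thesis by (simp only: if_False)
  qed
qed

lemma tents_lipschitz:
  assumes \<epsilon>: "\<And>j. \<bar>\<epsilon> j\<bar> \<le> 1"
  shows "\<bar>tents m \<epsilon> u - tents m \<epsilon> v\<bar> \<le> min 1 \<bar>u - v\<bar>"
proof -
  have abs_le: "\<bar>tents m \<epsilon> w\<bar> \<le> tent (w - \<lfloor>w\<rfloor>)" for w
    using mult_right_mono[OF \<epsilon>, of "tent (w - \<lfloor>w\<rfloor>)"] tent_bounds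
    by (auto simp: tents_eq abs_mult)
  \<comment> \<open>The signed sum of tents vanishes at every integer, and its slopes are at most
    \<open>1\<close> in modulus.\<close>
  have near_int: "\<bar>tents m \<epsilon> w\<bar> \<le> \<bar>w - real_of_int z\<bar>" for w z
  proof -
    have "tent (w - \<lfloor>w\<rfloor>) \<le> \<bar>w - real_of_int z\<bar>"
    proof (cases "z \<le> \<lfloor>w\<rfloor>")
      case True
      then have "real_of_int z \<le> \<lfloor>w\<rfloor>" by simp
      then show ?thesis by (auto simp: tent_def)
    next
      case False
      then have "real_of_int (\<lfloor>w\<rfloor> + 1) \<le> z" by (subst of_int_le_iff) simp
      then show ?thesis by (auto simp: tent_def)
    qed
    with abs_le[of w] show ?thesis by linarith
  qed
  have lip: "\<bar>tents m \<epsilon> u - tents m \<epsilon> v\<bar> \<le> \<bar>u - v\<bar>" if "u \<le> v" for u v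
  proof (cases "\<lfloor>u\<rfloor> = \<lfloor>v\<rfloor>")
    case True
    then have "0 \<le> u \<and> u < real m \<longleftrightarrow> 0 \<le> v \<and> v < real m"
      by (metis floor_less_iff of_int_of_nat_eq zero_le_floor)
    moreover have "\<bar>\<epsilon> k * tent (u - z) - \<epsilon> k * tent (v - z)\<bar> \<le> \<bar>u - v\<bar>" for k z
    proof -
      have "\<bar>\<epsilon> k\<bar> * \<bar>tent (u - z) - tent (v - z)\<bar> \<le> 1 * \<bar>(u - z) - (v - z)\<bar>"
        by (intro mult_mono \<epsilon> tent_lipschitz) auto
      then show ?thesis by (simp add: algebra_simps flip: abs_mult)
    qed
    ultimately show ?thesis
      using True by (auto simp: tents_eq)
  next
    case False
    \<comment> \<open>Signs may differ between cells, so \<open>u\<close> and \<open>v\<close> are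
      compared through the integer \<open>\<lfloor>v\<rfloor>\<close> between them, where the
      function vanishes.\<close>
    then have "u \<le> \<lfloor>v\<rfloor>" using \<open>u \<le> v\<close> by linarith
    with near_int[of u "\<lfloor>v\<rfloor>"] near_int[of v "\<lfloor>v\<rfloor>"] show ?thesis
      by linarith
  qed
  have "\<bar>tents m \<epsilon> w\<bar> \<le> 1/2" for w
    using abs_le[of w] tent_bounds(2)[of "w - \<lfloor>w\<rfloor>"] by linarith
  from this[of u] this[of v] lip[of u v] lip[of v u] show ?thesis
    by (cases "u \<le> v") (auto simp: abs_minus_commute)
qed

text \<open>The two geometric tails, of the scales below and above \<open>s\<^sup>2\<close>, are estimated at once; the
  right-hand side is a supersolution of the recursion \<open>\<phi> s = min 1 (s\<^sup>2) + \<phi> (2 * s) / 2\<close>.\<close>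

lemma sum_scales_le:
  assumes "0 \<le> (s::real)"
  shows "(\<Sum>k<L. min ((1/2) ^ k) (2 ^ k * s\<^sup>2)) \<le> (if 1 \<le> s then 2 else 3 * s - s\<^sup>2)"
  using assms
proof (induction L arbitrary: s)
  case 0
  then have "\<not> 1 \<le> s \<Longrightarrow> s * s \<le> 1 * s" by (intro mult_right_mono) auto
  with 0 show ?case by (auto simp: power2_eq_square)
next
  case (Suc L)
  have "(\<Sum>k<Suc L. min ((1/2) ^ k) (2 ^ k * s\<^sup>2))
      = min 1 (s\<^sup>2) + (\<Sum>k<L. (1/2) * min ((1/2) ^ k) (2 ^ k * (2 * s)\<^sup>2))"
    unfolding sum.lessThan_Suc_shift
    by (intro arg_cong2[where f = "(+)"] sum.cong refl)
       (simp_all add: min_def power2_eq_square field_simps)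
  also have "\<dots> \<le> min 1 (s\<^sup>2) + (1/2) * (if 1 \<le> 2 * s then 2 else 3 * (2 * s) - (2 * s)\<^sup>2)"
    unfolding sum_distrib_left[symmetric]
    using Suc.IH[of "2 * s"] Suc.prems by (intro add_left_mono mult_left_mono) auto
  also have "\<dots> \<le> (if 1 \<le> s then 2 else 3 * s - s\<^sup>2)"
  proof -
    consider "1 \<le> s" | "1/2 \<le> s" "s < 1" | "s < 1/2" by linarith
    then show ?thesis
    proof cases
      case 2
      \<comment> \<open>In this range the claim is \<open>s^2 + 1 \<le> 3 * s - s^2\<close>, which
        rearranges to this product.\<close>
      then have "(2 * s - 1) * (1 - s) \<ge> 0" by (intro mult_nonneg_nonneg) auto
      then show ?thesis using 2 by (auto simp: min_def power2_eq_square algebra_simps)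
    qed (auto simp: min_def power2_eq_square algebra_simps)
  qed
  finally show ?case .
qed

text \<open>Scale \<open>k\<close> varies by at most its amplitude and at most its slope
  \<open>2 ^ k\<close> times the distance. Summing the minimum of the two with
  \<open>s = sqrt \<bar>t - u\<bar>\<close> gives a constant independent of the number
  \<open>L\<close> of scales.\<close>

lemma multiscale_holder:
  assumes \<epsilon>: "\<And>k j. \<bar>\<epsilon> k j\<bar> \<le> 1"
  shows "\<bar>multiscale L \<epsilon> t - multiscale L \<epsilon> u\<bar> \<le> 3 * sqrt \<bar>t - u\<bar>"
proof -
  have "\<bar>multiscale L \<epsilon> t - multiscale L \<epsilon> u\<bar>
      \<le> (\<Sum>k<L. (1/2) ^ k * \<bar>tents (4 ^ k) (\<epsilon> k) (4 ^ k * t) - tents (4 ^ k) (\<epsilon> k) (4 ^ k * u)\<bar>)"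
    unfolding multiscale_def sum_subtractf[symmetric] right_diff_distrib[symmetric]
    by (rule order_trans[OF sum_abs]) (simp add: abs_mult)
  also have "\<dots> \<le> (\<Sum>k<L. min ((1/2) ^ k) (2 ^ k * (sqrt \<bar>t - u\<bar>)\<^sup>2))"
  proof (rule sum_mono)
    fix k
    have "\<bar>tents (4 ^ k) (\<epsilon> k) (4 ^ k * t) - tents (4 ^ k) (\<epsilon> k) (4 ^ k * u)\<bar>
        \<le> min 1 (4 ^ k * \<bar>t - u\<bar>)"
      using tents_lipschitz[of "\<epsilon> k" "4 ^ k" "4 ^ k * t" "4 ^ k * u"] \<epsilon>
      by (simp add: abs_mult flip: right_diff_distrib)
    then have "(1/2) ^ k * \<bar>tents (4 ^ k) (\<epsilon> k) (4 ^ k * t) - tents (4 ^ k) (\<epsilon> k) (4 ^ k * u)\<bar>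
        \<le> (1/2) ^ k * min 1 (4 ^ k * \<bar>t - u\<bar>)"
      by (intro mult_left_mono) auto
    also have "\<dots> = min ((1/2) ^ k) (2 ^ k * \<bar>t - u\<bar>)"
    proof -
      have "(1/2) ^ k * 4 ^ k = (2::real) ^ k"
        by (simp flip: power_mult_distrib)
      then show ?thesis
        by (simp add: min_mult_distrib_left mult.assoc[symmetric])
    qed
    finally show "(1/2) ^ k * \<bar>tents (4 ^ k) (\<epsilon> k) (4 ^ k * t) - tents (4 ^ k) (\<epsilon> k) (4 ^ k * u)\<bar>
        \<le> min ((1/2) ^ k) (2 ^ k * (sqrt \<bar>t - u\<bar>)\<^sup>2)"
      by simp
  qed
  also have "\<dots> \<le> (if 1 \<le> sqrt \<bar>t - u\<bar> then 2 else 3 * sqrt \<bar>t - u\<bar> - (sqrt \<bar>t - u\<bar>)\<^sup>2)"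
    by (rule sum_scales_le) simp
  also have "\<dots> \<le> 3 * sqrt \<bar>t - u\<bar>"
    by (cases "1 \<le> sqrt \<bar>t - u\<bar>"; simp only: if_True if_False) (linarith | simp)+
  finally show ?thesis .
qed

definition tent_discrepancy :: "nat \<Rightarrow> (nat \<Rightarrow> real) \<Rightarrow> (nat \<Rightarrow> real) \<Rightarrow> nat \<Rightarrow> nat \<Rightarrow> real" where
  "tent_discrepancy n x y k j =
     (\<Sum>i<n. tent (4 ^ k * x i - real j) - tent (4 ^ k * y i - real j))"

lemma sum_tent_discrepancy_le_boundary_cost:
  "(\<Sum>k<L. (1/2) ^ k * (\<Sum>j<4^k. \<bar>tent_discrepancy n x y k j\<bar>)) \<le> 3 * boundary_matching_cost n x y"
proof -
  \<comment> \<open>These signs turn every tent discrepancy into its absolute value; the factor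
    \<open>1/3\<close> in \<open>f\<close> normalises the Hoelder constant to
    \<open>1\<close>.\<close>
  define \<epsilon> where "\<epsilon> k j = sgn (tent_discrepancy n x y k j)" for k j
  define f where "f t = multiscale L \<epsilon> t / 3" for t
  have \<epsilon>: "\<bar>\<epsilon> k j\<bar> \<le> 1" for k j
    by (simp add: \<epsilon>_def sgn_if)
  have ends: "multiscale L \<epsilon> 0 = 0" "multiscale L \<epsilon> 1 = 0"
    by (simp_all add: multiscale_def tents_eq tent_def)
  have "multiscale L \<epsilon> t - multiscale L \<epsilon> u \<le> 3 * sqrt \<bar>t - u\<bar>" for t u
    using multiscale_holder[of \<epsilon> L t u] \<epsilon> by fastforce
  then have "f t - f u \<le> sqrt \<bar>t - u\<bar>" for t u
    by (simp add: f_def field_simps)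
  from holder_le_boundary_matching_cost[OF this, where n = n and x = x and y = y]
  have "(\<Sum>i<n. f (x i) - f (y i)) \<le> boundary_matching_cost n x y"
    using ends by (simp add: f_def)
  moreover have "(\<Sum>i<n. multiscale L \<epsilon> (x i) - multiscale L \<epsilon> (y i))
      = (\<Sum>k<L. (1/2) ^ k * (\<Sum>j<4^k. \<bar>tent_discrepancy n x y k j\<bar>))"
  proof -
    have "(\<Sum>i<n. multiscale L \<epsilon> (x i) - multiscale L \<epsilon> (y i))
      = (\<Sum>k<L. (1/2) ^ k * (\<Sum>i<n. \<Sum>j<4^k.
          \<epsilon> k j * (tent (4 ^ k * x i - real j) - tent (4 ^ k * y i - real j))))"
      unfolding multiscale_def tents_def sum_subtractf[symmetric] right_diff_distrib[symmetric]
        sum_distrib_left by (rule sum.swap)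
    also have "\<dots> = (\<Sum>k<L. (1/2) ^ k * (\<Sum>j<4^k. \<epsilon> k j * tent_discrepancy n x y k j))"
      unfolding tent_discrepancy_def sum_distrib_left
      by (intro sum.cong refl sum.swap)
    finally show ?thesis
      by (simp add: \<epsilon>_def abs_sgn mult.commute)
  qed
  ultimately show ?thesis
    by (simp add: f_def flip: diff_divide_distrib sum_divide_distrib)
qed

section \<open>Uniform samples\<close>

abbreviation unif :: "real measure" where
  "unif \<equiv> uniform_measure lborel {0..1}"

lemma prob_space_unif: "prob_space unif"
  by (rule prob_space_uniform_measure) auto

lemma measure_unif: "A \<in> sets borel \<Longrightarrow> measure unif A = measure lborel ({0..1} \<inter> A)"
  by simp

lemma measure_unif_Icc: "0 \<le> a \<Longrightarrow> a \<le> b \<Longrightarrow> b \<le> 1 \<Longrightarrow> measure unif {a..b} = b - a"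
  by (simp add: measure_unif Int_absorb1)

lemma measure_unif_Ioc: "0 \<le> a \<Longrightarrow> a \<le> b \<Longrightarrow> b \<le> 1 \<Longrightarrow> measure unif {a<..b} = b - a"
proof -
  assume "0 \<le> a" "a \<le> b" "b \<le> 1"
  then have "{0..1} \<inter> {a<..b} = {a<..b}" by auto
  with \<open>a \<le> b\<close> show ?thesis by (simp add: measure_unif)
qed

text \<open>The endpoints form a null set; the coupling lemmas require points in the open
  interval.\<close>

lemma AE_unif: "AE t in unif. t \<in> {0<..<1}"
proof -
  have "{0..1} \<inter> {0<..<1} = {0<..<1::real}"
    by auto
  then have "measure unif {0<..<1} = 1"
    by (simp add: measure_unif)
  then show ?thesis
    by (rule prob_space.AE_prob_1[OF prob_space_unif])
qed

lemma integrable_unif: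
  fixes u :: "real \<Rightarrow> 'b::{banach, second_countable_topology}"
  assumes "u \<in> borel_measurable borel" "\<And>t. norm (u t) \<le> B"
  shows "integrable unif u"
proof -
  interpret prob_space unif by (rule prob_space_unif)
  show ?thesis
    by (rule integrable_const_bound[of _ B]) (use assms in auto)
qed

locale uniform_samples = prob_space M for M :: "'a measure" +
  fixes X Y :: "nat \<Rightarrow> 'a \<Rightarrow> real"
  assumes indep: "indep_vars (\<lambda>_. borel) (case_sum X Y) UNIV"
    and distr_X: "\<And>i. distr M borel (X i) = unif"
    and distr_Y: "\<And>i. distr M borel (Y i) = unif"
begin

lemma measurable_X [measurable]: "X i \<in> borel_measurable M"
  using indep[unfolded indep_vars_def, THEN conjunct1, THEN bspec[of _ _ "Inl i"]] by simp

lemma measurable_Y [measurable]: "Y i \<in> borel_measurable M"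
  using indep[unfolded indep_vars_def, THEN conjunct1, THEN bspec[of _ _ "Inr i"]] by simp

lemma AE_samples: "AE \<omega> in M. \<forall>i. X i \<omega> \<in> {0<..<1} \<and> Y i \<omega> \<in> {0<..<1}"
proof -
  have "AE \<omega> in M. X i \<omega> \<in> {0<..<1}" for i
    by (rule AE_distrD[of "X i" M borel, OF measurable_X]) (simp only: distr_X AE_unif)
  moreover have "AE \<omega> in M. Y i \<omega> \<in> {0<..<1}" for i
    by (rule AE_distrD[of "Y i" M borel, OF measurable_Y]) (simp only: distr_Y AE_unif)
  ultimately show ?thesis by (simp add: AE_all_countable AE_conj_iff)
qed

text \<open>Stated over a general normed field: the real case yields exponential moments of counts,
  the complex case characteristic functions.\<close>

lemma
  fixes u v :: "real \<Rightarrow> 'b::{real_normed_field, banach, second_countable_topology}"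
  assumes u[measurable]: "u \<in> borel_measurable borel" and u_le: "\<And>t. norm (u t) \<le> B"
    and v[measurable]: "v \<in> borel_measurable borel" and v_le: "\<And>t. norm (v t) \<le> B"
  shows expectation_prod_samples:
      "expectation (\<lambda>\<omega>. (\<Prod>i<n. u (X i \<omega>)) * (\<Prod>i<n. v (Y i \<omega>))) =
        (\<integral>t. u t \<partial>unif) ^ n * (\<integral>t. v t \<partial>unif) ^ n"
    and integrable_prod_samples:
      "integrable M (\<lambda>\<omega>. (\<Prod>i<n. u (X i \<omega>)) * (\<Prod>i<n. v (Y i \<omega>)))"
proof -
  define g where "g s = (case s of Inl _ \<Rightarrow> u | Inr _ \<Rightarrow> v)" for s :: "nat + nat"
  let ?Z = "\<lambda>s \<omega>. g s (case_sum X Y s \<omega>)"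
  let ?I = "{..<n} <+> {..<n}"
  have "g s \<in> borel_measurable borel" for s
    by (auto simp: g_def split: sum.split)
  then have ind: "indep_vars (\<lambda>_. borel) ?Z ?I"
    by (intro indep_vars_compose2[OF indep_vars_subset[OF indep]]) auto
  have int: "integrable M (?Z s)" if "s \<in> ?I" for s
    by (rule integrable_const_bound[of _ B])
      (auto simp: g_def u_le v_le split: sum.split)
  have prod: "(\<Prod>s\<in>?I. ?Z s \<omega>) = (\<Prod>i<n. u (X i \<omega>)) * (\<Prod>i<n. v (Y i \<omega>))" for \<omega>
    by (simp add: prod.Plus g_def)
  have "expectation (\<lambda>\<omega>. u (X i \<omega>)) = (\<integral>t. u t \<partial>unif)" for i
    by (subst distr_X[of i, symmetric], subst integral_distr) auto
  moreover have "expectation (\<lambda>\<omega>. v (Y i \<omega>)) = (\<integral>t. v t \<partial>unif)" for i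
    by (subst distr_Y[of i, symmetric], subst integral_distr) auto
  ultimately have "(\<Prod>s\<in>?I. expectation (?Z s)) = (\<integral>t. u t \<partial>unif) ^ n * (\<integral>t. v t \<partial>unif) ^ n"
    by (simp add: prod.Plus g_def)
  with indep_vars_lebesgue_integral[OF _ ind int] indep_vars_integrable[OF _ ind int]
  show "expectation (\<lambda>\<omega>. (\<Prod>i<n. u (X i \<omega>)) * (\<Prod>i<n. v (Y i \<omega>))) =
        (\<integral>t. u t \<partial>unif) ^ n * (\<integral>t. v t \<partial>unif) ^ n"
    "integrable M (\<lambda>\<omega>. (\<Prod>i<n. u (X i \<omega>)) * (\<Prod>i<n. v (Y i \<omega>)))"
    by (simp_all add: prod)
qed

end

section \<open>Measurability and integrability of the two costs\<close>

lemma measurable_matching_cost: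
  assumes "\<And>i. (\<lambda>\<omega>. x \<omega> i) \<in> borel_measurable M" "\<And>i. (\<lambda>\<omega>. y \<omega> i) \<in> borel_measurable M"
  shows "(\<lambda>\<omega>. matching_cost n (x \<omega>) (y \<omega>)) \<in> borel_measurable M"
proof -
  have fin: "finite {\<sigma>. \<sigma> permutes {..<n}}"
    by (rule finite_permutations) simp
  have "{\<sigma>. \<sigma> permutes {..<n}} \<noteq> {}"
    using permutes_id by blast
  then have "matching_cost n (x \<omega>) (y \<omega>)
      = (INF \<sigma>\<in>{\<sigma>. \<sigma> permutes {..<n}}. \<Sum>i<n. \<bar>x \<omega> i - y \<omega> (\<sigma> i)\<bar> powr (1/2))" for \<omega>
    unfolding matching_cost_def using fin by (subst cInf_eq_Min) auto
  then show ?thesis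
    using assms fin by (simp, intro borel_measurable_cINF_real countable_finite) measurable
qed

text \<open>The boundary families range over an uncountable function space, but only
  \<open>m\<close> binary values of each matter. Coding them by boolean lists gives a countable
  infimum, which is measurable.\<close>

lemma boundary_matching_cost_eq_INF:
  "boundary_matching_cost n x y =
     (INF (m, bs, cs). matching_cost (n + m) (concat_family n x (\<lambda>j. of_bool (bs ! j)))
        (concat_family n y (\<lambda>j. of_bool (cs ! j))))"
proof -
  let ?c = "\<lambda>(m, bs, cs). matching_cost (n + m) (concat_family n x (\<lambda>j. of_bool (bs ! j)))
        (concat_family n y (\<lambda>j. of_bool (cs ! j)))"
  have "boundary_costs n x y = range ?c"
  proof (intro equalityI subsetI)
    fix c assume "c \<in> boundary_costs n x y"
    then obtain m x' y' where
      c: "c = matching_cost (n + m) (concat_family n x x') (concat_family n y y')"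
      and b: "\<And>j. j < m \<Longrightarrow> x' j \<in> {0, 1} \<and> y' j \<in> {0, 1}" by auto
    have "c = ?c (m, map (\<lambda>j. x' j = 1) [0..<m], map (\<lambda>j. y' j = 1) [0..<m])"
    proof (unfold c prod.case, rule matching_cost_cong)
      fix i assume "i < n + m"
      then have "\<not> i < n \<Longrightarrow> i - n < m" by simp
      with b[of "i - n"]
      show "concat_family n x x' i = concat_family n x (\<lambda>j. of_bool (map (\<lambda>j. x' j = 1) [0..<m] ! j)) i"
        "concat_family n y y' i = concat_family n y (\<lambda>j. of_bool (map (\<lambda>j. y' j = 1) [0..<m] ! j)) i"
        by (auto simp: concat_family_def)
    qed
    then show "c \<in> range ?c" by blast
  next
    fix c assume "c \<in> range ?c"
    then show "c \<in> boundary_costs n x y" by fastforce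
  qed
  then show ?thesis by (simp add: boundary_matching_cost_def)
qed

lemma measurable_boundary_matching_cost:
  assumes [measurable]: "\<And>i. (\<lambda>\<omega>. x \<omega> i) \<in> borel_measurable M" "\<And>i. (\<lambda>\<omega>. y \<omega> i) \<in> borel_measurable M"
  shows "(\<lambda>\<omega>. boundary_matching_cost n (x \<omega>) (y \<omega>)) \<in> borel_measurable M"
  unfolding boundary_matching_cost_eq_INF
proof (rule borel_measurable_cINF_real)
  fix q :: "nat \<times> bool list \<times> bool list"
  obtain m bs cs where q: "q = (m, bs, cs)" by (cases q)
  show "(\<lambda>\<omega>. case q of (m, bs, cs) \<Rightarrow> matching_cost (n + m)
      (concat_family n (x \<omega>) (\<lambda>j. of_bool (bs ! j))) (concat_family n (y \<omega>) (\<lambda>j. of_bool (cs ! j))))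
      \<in> borel_measurable M"
    unfolding q prod.case by (rule measurable_matching_cost) (simp_all add: concat_family_def)
qed simp

lemma matching_cost_le:
  assumes "\<And>i. i < n \<Longrightarrow> x i \<in> {0<..<1}" "\<And>i. i < n \<Longrightarrow> y i \<in> {0<..<1}"
  shows "matching_cost n x y \<le> n"
proof -
  have "matching_cost n x y \<le> (\<Sum>i<n. \<bar>x i - y (id i)\<bar> powr (1/2))"
    unfolding matching_cost_def
    by (intro Min_le finite_imageI finite_permutations imageI) (auto simp: permutes_id[unfolded id_def])
  also have "\<dots> \<le> (\<Sum>i<n. 1)"
  proof (intro sum_mono)
    fix i assume "i \<in> {..<n}"
    then have "\<bar>x i - y (id i)\<bar> \<le> 1"
      using assms(1)[of i] assms(2)[of i] by auto
    then show "\<bar>x i - y (id i)\<bar> powr (1/2) \<le> 1"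
      by (simp add: powr_half_sqrt)
  qed
  finally show ?thesis by simp
qed

context uniform_samples
begin

lemma integrable_matching_cost:
  "integrable M (\<lambda>\<omega>. matching_cost n (\<lambda>i. X i \<omega>) (\<lambda>i. Y i \<omega>))"
proof (rule integrable_const_bound[of _ "real n"])
  show "AE \<omega> in M. norm (matching_cost n (\<lambda>i. X i \<omega>) (\<lambda>i. Y i \<omega>)) \<le> real n"
    using AE_samples by eventually_elim (auto simp: matching_cost_nonneg intro!: matching_cost_le)
qed (rule measurable_matching_cost; measurable)

lemma integrable_boundary_matching_cost:
  "integrable M (\<lambda>\<omega>. boundary_matching_cost n (\<lambda>i. X i \<omega>) (\<lambda>i. Y i \<omega>))"
  by (rule Bochner_Integration.integrable_bound[OF integrable_matching_cost[of n]])
    (auto intro!: measurable_boundary_matching_cost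
      simp: boundary_matching_cost_nonneg matching_cost_nonneg boundary_le_matching_cost)

lemma expected_boundary_le_matching:
  "expected_boundary_matching_cost M X Y n \<le> expected_matching_cost M X Y n"
  unfolding expected_boundary_matching_cost_def expected_matching_cost_def
  by (intro integral_mono integrable_matching_cost integrable_boundary_matching_cost
      boundary_le_matching_cost)

end

section \<open>The discrepancy of two uniform samples\<close>

text \<open>Two sets are kept apart because on the fine grid the interval for \<open>y\<close> ends
  one grid point after the interval for \<open>x\<close>.\<close>

definition count_diff :: "nat \<Rightarrow> (nat \<Rightarrow> real) \<Rightarrow> (nat \<Rightarrow> real) \<Rightarrow> real set \<Rightarrow> real set \<Rightarrow> real" where
  "count_diff n x y A B = (\<Sum>i<n. indicator B (y i)) - (\<Sum>i<n. indicator A (x i))"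

text \<open>Sums of exponentials stand in for maxima over the grid points: they need only be estimated
  in expectation. Fine cell \<open>r\<close> has width \<open>1/(n N)\<close> and lies in the coarse cell \<open>r div n\<close>.\<close>

definition coarse_sum :: "nat \<Rightarrow> real \<Rightarrow> nat \<Rightarrow> (nat \<Rightarrow> real) \<Rightarrow> (nat \<Rightarrow> real) \<Rightarrow> real" where
  "coarse_sum N l n x y =
     (\<Sum>j<N. exp (l * count_diff n x y {0<..real j / real N} {0<..real j / real N}))"

definition fine_sum :: "nat \<Rightarrow> real \<Rightarrow> nat \<Rightarrow> (nat \<Rightarrow> real) \<Rightarrow> (nat \<Rightarrow> real) \<Rightarrow> real" where
  "fine_sum N l n x y =
     (\<Sum>r<n * N. exp (l * count_diff n x y
        {real (r div n) / real N<..real r / real (n * N)}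
        {real (r div n) / real N<..real (Suc r) / real (n * N)}))"

text \<open>A tangent bound for \<open>ln s\<close> at \<open>A\<close>, from
  \<open>ln z \<le> z - 1\<close>. It is linear in \<open>s\<close>, so after taking expectations a
  bound \<open>A\<close> for the mean of \<open>s\<close> suffices.\<close>

lemma le_log_of_exp_le:
  assumes "0 < l" "0 < A" "exp (l * c) \<le> s"
  shows "c \<le> (ln A + s / A) / (l::real)"
proof -
  have "l * c - ln A = ln (exp (l * c) / A)"
    using assms by (simp add: ln_div)
  also have "\<dots> \<le> exp (l * c) / A - 1"
    using assms by (intro ln_le_minus_one) auto
  also have "\<dots> \<le> s / A"
    using divide_right_mono[of "exp (l * c)" s A] assms by simp
  finally show ?thesis
    using assms by (simp add: field_simps)
qed

text \<open>Between fine grid points \<open>b < t \<le> b'\<close>, round the count of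
  \<open>y\<close> up to \<open>b'\<close> and that of \<open>x\<close> down to \<open>b\<close>,
  then split both at the coarse grid point \<open>a\<close>. The resulting bound does not involve
  \<open>t\<close>.\<close>

lemma discrepancy_le_grid_sums:
  assumes n: "0 < n" and N: "0 < N" and l: "0 < l1" "0 < l2" and A: "0 < A1" "0 < A2"
    and x: "\<And>i. i < n \<Longrightarrow> x i \<in> {0<..<1}" and y: "\<And>i. i < n \<Longrightarrow> y i \<in> {0<..<1}"
    and t: "0 < t" "t < 1"
  shows "(\<Sum>i<n. indicator {..t} (y i)) - (\<Sum>i<n. indicator {..<t} (x i))
    \<le> (ln A1 + coarse_sum N l1 n x y / A1) / l1 + (ln A2 + fine_sum N l2 n x y / A2) / (l2::real)"
proof -
  \<comment> \<open>Ceiling minus one makes \<open>b < t\<close> strict, so that points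
    \<open>x i \<le> b\<close> are counted by \<open>{..<t}\<close> even when \<open>t\<close> is a
    grid point.\<close>
  define r where "r = nat (\<lceil>t * real (n * N)\<rceil> - 1)"
  define j where "j = r div n"
  define a where "a = real j / real N"
  define b where "b = real r / real (n * N)"
  define b' where "b' = real (Suc r) / real (n * N)"
  have nN: "0 < real (n * N)" using n N by simp
  have pos: "0 < \<lceil>t * real (n * N)\<rceil>" using t nN by simp
  then have r: "real r = of_int \<lceil>t * real (n * N)\<rceil> - 1"
    by (simp add: r_def)
  then have bt: "b < t" and tb': "t \<le> b'"
    using nN unfolding b_def b'_def by (simp_all add: field_simps del: of_nat_mult; linarith)+
  have "real r < real (n * N)"
    using order.strict_trans[OF bt t(2)] nN unfolding b_def
    by (simp only: divide_less_eq_1_pos)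
  then have rN: "r < n * N" by (simp only: of_nat_less_iff)
  then have jN: "j < N" by (simp add: j_def less_mult_imp_div_less mult.commute)
  have "real (n * j) \<le> real r" unfolding of_nat_le_iff j_def by (simp add: times_div_less_eq_dividend)
  then have ab: "0 \<le> a" "a \<le> b"
    using n N unfolding a_def b_def by (simp_all add: field_simps)
  have ind_y: "indicator {..t} (y i) \<le> (indicator {0<..a} (y i) + indicator {a<..b'} (y i) :: real)"
    if "i < n" for i using y[OF that] tb' by (auto simp: indicator_def)
  have ind_x: "indicator {0<..a} (x i) + indicator {a<..b} (x i) \<le> (indicator {..<t} (x i) :: real)"
    if "i < n" for i using x[OF that] bt ab by (auto simp: indicator_def)
  have "(\<Sum>i<n. indicator {..t} (y i)) - (\<Sum>i<n. indicator {..<t} (x i))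
      \<le> (\<Sum>i<n. indicator {0<..a} (y i) + indicator {a<..b'} (y i))
        - (\<Sum>i<n. indicator {0<..a} (x i) + indicator {a<..b} (x i) :: real)"
    by (intro diff_mono sum_mono ind_y ind_x) auto
  also have "\<dots> = count_diff n x y {0<..a} {0<..a} + count_diff n x y {a<..b} {a<..b'}"
    by (simp add: count_diff_def sum.distrib)
  also have "count_diff n x y {0<..a} {0<..a} \<le> (ln A1 + coarse_sum N l1 n x y / A1) / l1"
    using jN by (intro le_log_of_exp_le l A)
      (auto simp: coarse_sum_def a_def intro!: member_le_sum)
  also have "count_diff n x y {a<..b} {a<..b'} \<le> (ln A2 + fine_sum N l2 n x y / A2) / l2"
    using rN unfolding fine_sum_def a_def b_def b'_def j_def
    by (intro le_log_of_exp_le l A member_le_sum) auto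
  finally show ?thesis by simp
qed

lemma integral_exp_indicator:
  assumes [measurable]: "J \<in> sets borel"
  shows "(\<integral>t. exp (c * indicator J t) \<partial>unif) = 1 + measure unif J * (exp c - 1)"
proof -
  interpret U: prob_space unif by (rule prob_space_unif)
  have "exp (c * indicator J t) = 1 + (exp c - 1) * indicator J t" for t :: real
    by (simp add: indicator_def)
  then have "(\<integral>t. exp (c * indicator J t) \<partial>unif) = (\<integral>t. 1 + (exp c - 1) * indicator J t \<partial>unif)"
    by simp
  also have "\<dots> = 1 + (exp c - 1) * measure unif J"
    by (subst Bochner_Integration.integral_add) (auto intro!: integrable_unif[of _ 1] simp: U.prob_space)
  finally show ?thesis by simp
qed

lemma exp_le_quadratic:
  assumes "x \<le> 1"
  shows "exp x \<le> 1 + x + (x::real)\<^sup>2"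
proof (cases "0 \<le> x")
  case True
  then show ?thesis using exp_bound[of x] assms by simp
next
  case False
  have "x * x\<^sup>2 \<le> 0" using False by (simp add: mult_nonpos_nonneg)
  \<comment> \<open>The product equals \<open>1 - x^3\<close>, and \<open>x\<close> is negative
    here.\<close>
  then have "1 \<le> (1 + x + x\<^sup>2) * (1 - x)"
    by (simp add: algebra_simps power2_eq_square)
  also have "\<dots> \<le> (1 + x + x\<^sup>2) * exp (- x)"
    using exp_ge_add_one_self[of "-x"] zero_le_power2[of "x + 1/2"]
    by (intro mult_left_mono) (auto simp: power2_eq_square algebra_simps)
  finally show ?thesis by (simp add: exp_minus field_simps)
qed

context uniform_samples
begin

text \<open>By independence the moment is a product of Bernoulli factors
  \<open>1 + q * (exp c - 1)\<close>, each at most \<open>exp (q * (exp c - 1))\<close>, the Poisson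
  bound.\<close>

lemma expectation_exp_counts:
  assumes [measurable]: "A \<in> sets borel" "B \<in> sets borel"
  shows "expectation (\<lambda>\<omega>. exp (c * (\<Sum>i<n. indicator A (X i \<omega>)) + d * (\<Sum>i<n. indicator B (Y i \<omega>))))
      \<le> exp (real n * (measure unif A * (exp c - 1) + measure unif B * (exp d - 1)))" (is ?le)
    and "integrable M (\<lambda>\<omega>. exp (c * (\<Sum>i<n. indicator A (X i \<omega>)) + d * (\<Sum>i<n. indicator B (Y i \<omega>))))" (is ?int)
proof -
  interpret U: prob_space unif by (rule prob_space_unif)
  let ?u = "\<lambda>t. exp (c * indicator A t)" and ?v = "\<lambda>t. exp (d * indicator B t) :: real"
  have bound: "norm (?u t) \<le> exp (\<bar>c\<bar> + \<bar>d\<bar>)" "norm (?v t) \<le> exp (\<bar>c\<bar> + \<bar>d\<bar>)" for t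
    by (auto simp: indicator_def)
  have eq: "exp (c * (\<Sum>i<n. indicator A (X i \<omega>)) + d * (\<Sum>i<n. indicator B (Y i \<omega>)))
      = (\<Prod>i<n. ?u (X i \<omega>)) * (\<Prod>i<n. ?v (Y i \<omega>))" for \<omega>
    by (simp only: exp_add exp_sum[OF finite_lessThan] sum_distrib_left)
  show ?int
    unfolding eq by (rule integrable_prod_samples[OF _ bound(1) _ bound(2)]) measurable
  have le: "0 \<le> 1 + measure unif J * (exp e - 1)" "1 + measure unif J * (exp e - 1) \<le> exp (measure unif J * (exp e - 1))"
    if "J \<in> sets borel" for J and e :: real
  proof -
    have "0 \<le> (\<integral>t. exp (e * indicator J t) \<partial>unif)"
      by (rule Bochner_Integration.integral_nonneg) simp
    then show "0 \<le> 1 + measure unif J * (exp e - 1)"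
      unfolding integral_exp_indicator[OF that] .
  qed (rule exp_ge_add_one_self)
  have "expectation (\<lambda>\<omega>. (\<Prod>i<n. ?u (X i \<omega>)) * (\<Prod>i<n. ?v (Y i \<omega>)))
      = (1 + measure unif A * (exp c - 1)) ^ n * (1 + measure unif B * (exp d - 1)) ^ n"
    by (subst expectation_prod_samples[OF _ bound(1) _ bound(2)]) (simp_all only: integral_exp_indicator assms, measurable)
  also have "\<dots> \<le> exp (measure unif A * (exp c - 1)) ^ n * exp (measure unif B * (exp d - 1)) ^ n"
    by (intro mult_mono power_mono le zero_le_power) auto
  also have "\<dots> = exp (real n * (measure unif A * (exp c - 1) + measure unif B * (exp d - 1)))"
    by (simp add: exp_add distrib_left flip: exp_of_nat_mult)
  finally show ?le unfolding eq .
qed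

text \<open>On the common part \<open>{a<..b}\<close> the first-order terms cancel and
  \<open>exp l + exp (-l) - 2\<close> is quadratic in \<open>l\<close>; only the surplus
  \<open>{b<..b'}\<close> contributes linearly. Both orders of the samples are covered, since the
  discrepancy is needed in both directions.\<close>

lemma expectation_exp_count_diff:
  assumes ab: "0 \<le> a" "a \<le> b" "b \<le> b'" "b' \<le> 1" and l: "0 \<le> l" "l \<le> 1"
  shows "expectation (\<lambda>\<omega>. exp (l * count_diff n (\<lambda>i. X i \<omega>) (\<lambda>i. Y i \<omega>) {a<..b} {a<..b'}))
      \<le> exp (real n * (2 * (b - a) * l\<^sup>2 + 2 * (b' - b) * l))" (is "?E1 \<le> ?R")
    and "expectation (\<lambda>\<omega>. exp (l * count_diff n (\<lambda>i. Y i \<omega>) (\<lambda>i. X i \<omega>) {a<..b} {a<..b'}))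
      \<le> exp (real n * (2 * (b - a) * l\<^sup>2 + 2 * (b' - b) * l))" (is "?E2 \<le> ?R")
    and "integrable M (\<lambda>\<omega>. exp (l * count_diff n (\<lambda>i. X i \<omega>) (\<lambda>i. Y i \<omega>) {a<..b} {a<..b'}))" (is ?I1)
    and "integrable M (\<lambda>\<omega>. exp (l * count_diff n (\<lambda>i. Y i \<omega>) (\<lambda>i. X i \<omega>) {a<..b} {a<..b'}))" (is ?I2)
proof -
  have "exp l + exp (-l) - 2 \<le> 2 * l\<^sup>2"
    using exp_le_quadratic[of l] exp_le_quadratic[of "-l"] l by simp
  then have "(b - a) * (exp l + exp (-l) - 2) \<le> (b - a) * (2 * l\<^sup>2)"
    using ab by (intro mult_left_mono) auto
  moreover have "exp l - 1 \<le> 2 * l"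
    using exp_le_quadratic[of l] l mult_left_mono[of l 1 l] by (simp add: power2_eq_square)
  then have "(b' - b) * (exp l - 1) \<le> (b' - b) * (2 * l)"
    using ab by (intro mult_left_mono) auto
  ultimately have le: "(b - a) * (exp (-l) - 1) + (b' - a) * (exp l - 1)
      \<le> 2 * (b - a) * l\<^sup>2 + 2 * (b' - b) * l"
    by (simp add: algebra_simps)
  have m: "measure unif {a<..b} = b - a" "measure unif {a<..b'} = b' - a"
    using ab by (intro measure_unif_Ioc; simp)+
  have eq1: "l * count_diff n (\<lambda>i. X i \<omega>) (\<lambda>i. Y i \<omega>) {a<..b} {a<..b'}
    = (-l) * (\<Sum>i<n. indicator {a<..b} (X i \<omega>)) + l * (\<Sum>i<n. indicator {a<..b'} (Y i \<omega>))" for \<omega>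
    by (simp add: count_diff_def algebra_simps)
  have eq2: "l * count_diff n (\<lambda>i. Y i \<omega>) (\<lambda>i. X i \<omega>) {a<..b} {a<..b'}
    = l * (\<Sum>i<n. indicator {a<..b'} (X i \<omega>)) + (-l) * (\<Sum>i<n. indicator {a<..b} (Y i \<omega>))" for \<omega>
    by (simp add: count_diff_def algebra_simps)
  show ?I1 ?I2 unfolding eq1 eq2 by (rule expectation_exp_counts; simp)+
  have "?E1 \<le> exp (real n * ((b - a) * (exp (-l) - 1) + (b' - a) * (exp l - 1)))"
    unfolding eq1 using expectation_exp_counts(1)[of "{a<..b}" "{a<..b'}" "-l" n l] by (simp only: m) simp
  also have "\<dots> \<le> ?R" using le by (simp add: mult_left_mono)
  finally show "?E1 \<le> ?R" .
  have "?E2 \<le> exp (real n * ((b' - a) * (exp l - 1) + (b - a) * (exp (-l) - 1)))"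
    unfolding eq2 using expectation_exp_counts(1)[of "{a<..b'}" "{a<..b}" l n "-l"] by (simp only: m) simp
  also have "\<dots> \<le> ?R" using le by (simp add: mult_left_mono add.commute)
  finally show "?E2 \<le> ?R" .
qed

lemma expectation_coarse_sum:
  assumes l: "0 \<le> l" "l \<le> 1"
  shows "expectation (\<lambda>\<omega>. coarse_sum N l n (\<lambda>i. X i \<omega>) (\<lambda>i. Y i \<omega>)) \<le> real N * exp (2 * real n * l\<^sup>2)"
    and "expectation (\<lambda>\<omega>. coarse_sum N l n (\<lambda>i. Y i \<omega>) (\<lambda>i. X i \<omega>)) \<le> real N * exp (2 * real n * l\<^sup>2)"
    and "integrable M (\<lambda>\<omega>. coarse_sum N l n (\<lambda>i. X i \<omega>) (\<lambda>i. Y i \<omega>))"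
    and "integrable M (\<lambda>\<omega>. coarse_sum N l n (\<lambda>i. Y i \<omega>) (\<lambda>i. X i \<omega>))"
proof -
  have q: "0 \<le> (0::real)" "0 \<le> real j / real N" "real j / real N \<le> real j / real N" "real j / real N \<le> 1"
    if "j < N" for j using that by (auto simp: field_simps)
  note E = expectation_exp_count_diff[OF q l]
  have le: "exp (real n * (2 * (real j / real N - 0) * l\<^sup>2 + 2 * (real j / real N - real j / real N) * l))
      \<le> exp (2 * real n * l\<^sup>2)" if "j < N" for j
    using q[OF that] mult_right_mono[of "real j / real N" 1 "2 * real n * l\<^sup>2"] by (simp add: algebra_simps)
  show "integrable M (\<lambda>\<omega>. coarse_sum N l n (\<lambda>i. X i \<omega>) (\<lambda>i. Y i \<omega>))"
    "integrable M (\<lambda>\<omega>. coarse_sum N l n (\<lambda>i. Y i \<omega>) (\<lambda>i. X i \<omega>))"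
    unfolding coarse_sum_def by (intro Bochner_Integration.integrable_sum E(3,4); simp)+
  have "(\<Sum>j<N. expectation (\<lambda>\<omega>. exp (l * count_diff n (\<lambda>i. X i \<omega>) (\<lambda>i. Y i \<omega>)
      {0<..real j / real N} {0<..real j / real N}))) \<le> (\<Sum>j<N. exp (2 * real n * l\<^sup>2))"
    by (intro sum_mono order_trans[OF E(1) le]) auto
  then show "expectation (\<lambda>\<omega>. coarse_sum N l n (\<lambda>i. X i \<omega>) (\<lambda>i. Y i \<omega>)) \<le> real N * exp (2 * real n * l\<^sup>2)"
    unfolding coarse_sum_def by (subst Bochner_Integration.integral_sum) (auto intro: E(3))
  have "(\<Sum>j<N. expectation (\<lambda>\<omega>. exp (l * count_diff n (\<lambda>i. Y i \<omega>) (\<lambda>i. X i \<omega>)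
      {0<..real j / real N} {0<..real j / real N}))) \<le> (\<Sum>j<N. exp (2 * real n * l\<^sup>2))"
    by (intro sum_mono order_trans[OF E(2) le]) auto
  then show "expectation (\<lambda>\<omega>. coarse_sum N l n (\<lambda>i. Y i \<omega>) (\<lambda>i. X i \<omega>)) \<le> real N * exp (2 * real n * l\<^sup>2)"
    unfolding coarse_sum_def by (subst Bochner_Integration.integral_sum) (auto intro: E(4))
qed

lemma expectation_fine_sum:
  assumes l: "0 \<le> l" "l \<le> 1" and N: "0 < N" and n: "0 < n"
  shows "expectation (\<lambda>\<omega>. fine_sum N l n (\<lambda>i. X i \<omega>) (\<lambda>i. Y i \<omega>)) \<le> real n * real N * exp (2 * real n * l\<^sup>2 / real N + 2)"
    and "expectation (\<lambda>\<omega>. fine_sum N l n (\<lambda>i. Y i \<omega>) (\<lambda>i. X i \<omega>)) \<le> real n * real N * exp (2 * real n * l\<^sup>2 / real N + 2)"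
    and "integrable M (\<lambda>\<omega>. fine_sum N l n (\<lambda>i. X i \<omega>) (\<lambda>i. Y i \<omega>))"
    and "integrable M (\<lambda>\<omega>. fine_sum N l n (\<lambda>i. Y i \<omega>) (\<lambda>i. X i \<omega>))"
proof -
  let ?a = "\<lambda>r. real (r div n) / real N" and ?b = "\<lambda>r. real r / real (n * N)"
  have div: "real r = real n * real (r div n) + real (r mod n)" for r
    by (metis mult_div_mod_eq of_nat_add of_nat_mult)
  have q: "0 \<le> ?a r" "?a r \<le> ?b r" "?b r \<le> ?b (Suc r)" "?b (Suc r) \<le> 1" if "r < n * N" for r
  proof -
    show "?a r \<le> ?b r" using div[of r] n N by (simp add: field_simps)
    have "real (Suc r) \<le> real (n * N)" unfolding of_nat_le_iff using that by simp
    then show "?b (Suc r) \<le> 1" using n N by (simp add: field_simps)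
  qed (simp_all add: divide_right_mono)
  note E = expectation_exp_count_diff[OF q l]
  have le: "exp (real n * (2 * (?b r - ?a r) * l\<^sup>2 + 2 * (?b (Suc r) - ?b r) * l))
      \<le> exp (2 * real n * l\<^sup>2 / real N + 2)" for r
  proof -
    have "r mod n \<le> n" using n by simp
    then have "real n * (?b r - ?a r) \<le> real n / real N"
      using div[of r] n N by (simp add: field_simps)
    then have "(real n * (?b r - ?a r)) * (2 * l\<^sup>2) \<le> (real n / real N) * (2 * l\<^sup>2)"
      by (rule mult_right_mono) simp
    \<comment> \<open>A fine cell expects only \<open>1 / N\<close> points per sample, so rounding
      \<open>t\<close> to the fine grid adds at most \<open>2\<close> to the exponent.\<close>
    moreover have "real n * (?b (Suc r) - ?b r) = 1 / real N"
      using n N by (simp add: field_simps)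
    then have "(real n * (?b (Suc r) - ?b r)) * (2 * l) \<le> 1 * (2 * 1)"
      using l N by (intro mult_mono) auto
    moreover have "real n * (2 * u * l\<^sup>2 + 2 * w * l) \<le> 2 * real n * l\<^sup>2 / real N + 2"
      if "(real n * u) * (2 * l\<^sup>2) \<le> (real n / real N) * (2 * l\<^sup>2)" "(real n * w) * (2 * l) \<le> 1 * (2 * 1)"
      for u w
      using that by (simp add: algebra_simps)
    ultimately show ?thesis
      unfolding exp_le_cancel_iff by blast
  qed
  show "integrable M (\<lambda>\<omega>. fine_sum N l n (\<lambda>i. X i \<omega>) (\<lambda>i. Y i \<omega>))"
    "integrable M (\<lambda>\<omega>. fine_sum N l n (\<lambda>i. Y i \<omega>) (\<lambda>i. X i \<omega>))"
    unfolding fine_sum_def by (intro Bochner_Integration.integrable_sum E(3,4); simp)+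
  have "(\<Sum>r<n * N. expectation (\<lambda>\<omega>. exp (l * count_diff n (\<lambda>i. X i \<omega>) (\<lambda>i. Y i \<omega>)
      {?a r<..?b r} {?a r<..?b (Suc r)}))) \<le> (\<Sum>r<n * N. exp (2 * real n * l\<^sup>2 / real N + 2))"
    by (intro sum_mono order_trans[OF E(1) le]) auto
  then show "expectation (\<lambda>\<omega>. fine_sum N l n (\<lambda>i. X i \<omega>) (\<lambda>i. Y i \<omega>)) \<le> real n * real N * exp (2 * real n * l\<^sup>2 / real N + 2)"
    unfolding fine_sum_def by (subst Bochner_Integration.integral_sum) ((rule E(3), simp) | simp)+
  have "(\<Sum>r<n * N. expectation (\<lambda>\<omega>. exp (l * count_diff n (\<lambda>i. Y i \<omega>) (\<lambda>i. X i \<omega>)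
      {?a r<..?b r} {?a r<..?b (Suc r)}))) \<le> (\<Sum>r<n * N. exp (2 * real n * l\<^sup>2 / real N + 2))"
    by (intro sum_mono order_trans[OF E(2) le]) auto
  then show "expectation (\<lambda>\<omega>. fine_sum N l n (\<lambda>i. Y i \<omega>) (\<lambda>i. X i \<omega>)) \<le> real n * real N * exp (2 * real n * l\<^sup>2 / real N + 2)"
    unfolding fine_sum_def by (subst Bochner_Integration.integral_sum) ((rule E(4), simp) | simp)+
qed

text \<open>The pathwise comparison is applied with a random discrepancy bound and then averaged.
  The parameters \<open>N\<close>, \<open>l1\<close>, \<open>l2\<close> stay free to be tuned to
  \<open>n\<close>.\<close>

lemma expected_matching_le_boundary:
  assumes n: "0 < n" and N: "0 < N" and l1: "0 < l1" "l1 \<le> 1" and l2: "0 < l2" "l2 \<le> 1"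
  shows "expected_matching_cost M X Y n - expected_boundary_matching_cost M X Y n
    \<le> 2 * ((ln (real N) + 2 * real n * l1\<^sup>2 + 1) / l1 + (ln (real n) + ln (real N) + 2 * real n * l2\<^sup>2 / real N + 3) / l2)"
proof -
  \<comment> \<open>\<open>A1\<close> and \<open>A2\<close> are the bounds on the expected grid
    sums, so each normalised sum has mean at most \<open>1\<close>.\<close>
  define A1 where "A1 = real N * exp (2 * real n * l1\<^sup>2)"
  define A2 where "A2 = real n * real N * exp (2 * real n * l2\<^sup>2 / real N + 2)"
  have N1: "1 \<le> real N" "1 \<le> real n" using n N by auto
  have "1 * 1 \<le> A1" unfolding A1_def using N1 by (intro mult_mono) auto
  moreover have "1 * 1 * 1 \<le> A2" unfolding A2_def using N1 by (intro mult_mono) auto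
  ultimately have A: "1 \<le> A1" "1 \<le> A2" by auto
  have ln_A: "ln A1 = ln (real N) + 2 * real n * l1\<^sup>2" "ln A2 = ln (real n) + ln (real N) + (2 * real n * l2\<^sup>2 / real N + 2)"
    using n N by (simp_all add: A1_def A2_def ln_mult)
  define G where "G x y = (ln A1 + coarse_sum N l1 n x y / A1) / l1 + (ln A2 + fine_sum N l2 n x y / A2) / l2"
    for x y
  have G: "0 \<le> G x y" for x y
    unfolding G_def coarse_sum_def fine_sum_def using A l1 l2
    by (intro add_nonneg_nonneg divide_nonneg_pos ln_ge_zero sum_nonneg) auto
  \<comment> \<open>Both one-sided bounds are nonnegative, so their sum dominates each; this is the
    origin of the factor \<open>2\<close>.\<close>
  define Z where "Z \<omega> = G (\<lambda>i. X i \<omega>) (\<lambda>i. Y i \<omega>) + G (\<lambda>i. Y i \<omega>) (\<lambda>i. X i \<omega>)" for \<omega>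
  have le: "matching_cost n (\<lambda>i. X i \<omega>) (\<lambda>i. Y i \<omega>) \<le> boundary_matching_cost n (\<lambda>i. X i \<omega>) (\<lambda>i. Y i \<omega>) + Z \<omega>"
    if "\<forall>i. X i \<omega> \<in> {0<..<1} \<and> Y i \<omega> \<in> {0<..<1}" for \<omega>
  proof (rule matching_cost_le_boundary)
    fix t :: real assume t: "0 < t" "t < 1"
    have "(\<Sum>i<n. indicator {..t} (Y i \<omega>)) - (\<Sum>i<n. indicator {..<t} (X i \<omega>)) \<le> G (\<lambda>i. X i \<omega>) (\<lambda>i. Y i \<omega>)"
      unfolding G_def using that A t n N l1 l2 by (intro discrepancy_le_grid_sums) auto
    with G show "(\<Sum>i<n. indicator {..t} (Y i \<omega>)) - (\<Sum>i<n. indicator {..<t} (X i \<omega>)) \<le> Z \<omega>"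
      unfolding Z_def by (smt (verit))
    have "(\<Sum>i<n. indicator {..t} (X i \<omega>)) - (\<Sum>i<n. indicator {..<t} (Y i \<omega>)) \<le> G (\<lambda>i. Y i \<omega>) (\<lambda>i. X i \<omega>)"
      unfolding G_def using that A t n N l1 l2 by (intro discrepancy_le_grid_sums) auto
    with G show "(\<Sum>i<n. indicator {..t} (X i \<omega>)) - (\<Sum>i<n. indicator {..<t} (Y i \<omega>)) \<le> Z \<omega>"
      unfolding Z_def by (smt (verit))
  qed (use that G in \<open>auto simp: Z_def\<close>)
  note C = expectation_coarse_sum[OF less_imp_le[OF l1(1)] l1(2), of N n, folded A1_def]
    and F = expectation_fine_sum[OF less_imp_le[OF l2(1)] l2(2) N n, folded A2_def]
  have intG: "integrable M (\<lambda>\<omega>. G (\<lambda>i. X i \<omega>) (\<lambda>i. Y i \<omega>))" "integrable M (\<lambda>\<omega>. G (\<lambda>i. Y i \<omega>) (\<lambda>i. X i \<omega>))"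
    unfolding G_def using C(3,4) F(3,4) by auto
  have bound: "(ln A1 + c / A1) / l1 + (ln A2 + d / A2) / l2
      \<le> (ln (real N) + 2 * real n * l1\<^sup>2 + 1) / l1 + (ln (real n) + ln (real N) + 2 * real n * l2\<^sup>2 / real N + 3) / l2"
    if "c \<le> A1" "d \<le> A2" for c d
  proof -
    have "c / A1 \<le> 1" "d / A2 \<le> 1" using that A by auto
    then have "ln A1 + c / A1 \<le> ln (real N) + 2 * real n * l1\<^sup>2 + 1"
        "ln A2 + d / A2 \<le> ln (real n) + ln (real N) + 2 * real n * l2\<^sup>2 / real N + 3" by (auto simp: ln_A)
    then show ?thesis
      using l1 l2 by (intro add_mono[OF divide_right_mono divide_right_mono]) auto
  qed
  have EG: "expectation (\<lambda>\<omega>. G (x \<omega>) (y \<omega>)) = (ln A1 + expectation (\<lambda>\<omega>. coarse_sum N l1 n (x \<omega>) (y \<omega>)) / A1) / l1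
      + (ln A2 + expectation (\<lambda>\<omega>. fine_sum N l2 n (x \<omega>) (y \<omega>)) / A2) / l2"
    if "integrable M (\<lambda>\<omega>. coarse_sum N l1 n (x \<omega>) (y \<omega>))" "integrable M (\<lambda>\<omega>. fine_sum N l2 n (x \<omega>) (y \<omega>))"
    for x y
    unfolding G_def using that by (simp add: prob_space)
  have "expected_matching_cost M X Y n
      \<le> expectation (\<lambda>\<omega>. boundary_matching_cost n (\<lambda>i. X i \<omega>) (\<lambda>i. Y i \<omega>) + Z \<omega>)"
    unfolding expected_matching_cost_def
  proof (rule integral_mono_AE[OF integrable_matching_cost])
    show "integrable M (\<lambda>\<omega>. boundary_matching_cost n (\<lambda>i. X i \<omega>) (\<lambda>i. Y i \<omega>) + Z \<omega>)"
      unfolding Z_def by (intro Bochner_Integration.integrable_add integrable_boundary_matching_cost intG)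
    show "AE \<omega> in M. matching_cost n (\<lambda>i. X i \<omega>) (\<lambda>i. Y i \<omega>)
        \<le> boundary_matching_cost n (\<lambda>i. X i \<omega>) (\<lambda>i. Y i \<omega>) + Z \<omega>"
      using AE_samples by (rule AE_mp) (intro AE_I2 impI le)
  qed
  also have "\<dots> = expected_boundary_matching_cost M X Y n + (expectation (\<lambda>\<omega>. G (\<lambda>i. X i \<omega>) (\<lambda>i. Y i \<omega>))
      + expectation (\<lambda>\<omega>. G (\<lambda>i. Y i \<omega>) (\<lambda>i. X i \<omega>)))"
    unfolding expected_boundary_matching_cost_def Z_def
    by (simp add: integrable_boundary_matching_cost intG)
  also have "expectation (\<lambda>\<omega>. G (\<lambda>i. X i \<omega>) (\<lambda>i. Y i \<omega>))
      \<le> (ln (real N) + 2 * real n * l1\<^sup>2 + 1) / l1 + (ln (real n) + ln (real N) + 2 * real n * l2\<^sup>2 / real N + 3) / l2"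
    unfolding EG[OF C(3) F(3)] by (rule bound[OF C(1) F(1)])
  also have "expectation (\<lambda>\<omega>. G (\<lambda>i. Y i \<omega>) (\<lambda>i. X i \<omega>))
      \<le> (ln (real N) + 2 * real n * l1\<^sup>2 + 1) / l1 + (ln (real n) + ln (real N) + 2 * real n * l2\<^sup>2 / real N + 3) / l2"
    unfolding EG[OF C(4) F(4)] by (rule bound[OF C(2) F(2)])
  finally show ?thesis by simp
qed

end

section \<open>The lower bound\<close>

text \<open>Used to bound a first absolute moment from below by a characteristic function.\<close>

lemma one_minus_cos_le_abs: "1 - cos v \<le> \<bar>v\<bar>" for v :: real
proof -
  have "1 - cos v = 2 * (sin (v/2))\<^sup>2"
    using cos_double_sin[of "v/2"] by simp
  also have "\<dots> = 2 * (\<bar>sin (v/2)\<bar> * \<bar>sin (v/2)\<bar>)"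
    by (simp add: power2_eq_square)
  also have "\<dots> \<le> 2 * (\<bar>v/2\<bar> * 1)"
    by (intro mult_left_mono mult_mono abs_sin_x_le_abs_x) auto
  finally show ?thesis by simp
qed

lemma quadratic_le_one_minus_cos:
  fixes v :: real
  assumes "0 \<le> v" "v \<le> 1"
  shows "v\<^sup>2 / 4 \<le> 1 - cos v"
proof -
  have "\<bar>sin (v/2) - v/2\<bar> \<le> inverse (fact 3) * \<bar>v/2\<bar> ^ 3"
    using Maclaurin_sin_bound[of "v/2" 3] by (simp add: eval_nat_numeral sin_coeff_def)
  moreover have "\<bar>v/2\<bar> ^ 3 \<le> \<bar>v/2\<bar> ^ 1"
    using assms by (intro power_decreasing) auto
  ultimately have "\<bar>sin (v/2) - v/2\<bar> \<le> (v/2) / 6"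
    using assms by (simp add: eval_nat_numeral)
  \<comment> \<open>\<open>1/2 - 1/12 = 5/12\<close>, and \<open>2 * (5/12)^2 = 25/72\<close>
    exceeds the required \<open>1/4\<close>.\<close>
  then have "5/12 * v \<le> sin (v/2)" by linarith
  then have "(5/12 * v)\<^sup>2 \<le> (sin (v/2))\<^sup>2"
    using assms by (intro power_mono) auto
  moreover have "1 - cos v = 2 * (sin (v/2))\<^sup>2"
    using cos_double_sin[of "v/2"] by simp
  ultimately show ?thesis
    using zero_le_power2[of v] unfolding power_mult_distrib power2_eq_square by linarith
qed

text \<open>The characteristic function at \<open>l\<close> of tent \<open>j\<close> of scale
  \<open>k\<close>, evaluated at a uniform point.\<close>

definition tent_char :: "nat \<Rightarrow> nat \<Rightarrow> real \<Rightarrow> complex" where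
  "tent_char k j l = (\<integral>t. cis (l * tent (4 ^ k * t - real j)) \<partial>unif)"

lemma measurable_tent [measurable]: "tent \<in> borel_measurable borel"
  unfolding tent_def by measurable

text \<open>Write the value as \<open>(1 - d) + i e\<close> and let \<open>p\<close> be the tent
  width. The loss \<open>d\<close> is at least of order \<open>l^2 * p\<close>, while
  \<open>e^2\<close> is at most of order \<open>l^2 * p^2\<close>, hence absorbed when
  \<open>p\<close> is small.\<close>

lemma tent_char_bound:
  assumes k: "3 \<le> k" and j: "j < 4 ^ k" and l: "0 \<le> l" "l \<le> 1"
  shows "(cmod (tent_char k j l))\<^sup>2 \<le> 1 - l\<^sup>2 / (256 * 4 ^ k)"
proof -
  interpret U: prob_space unif by (rule prob_space_unif)
  define p where "p = 1 / (4::real) ^ k"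
  define h where "h t = tent (4 ^ k * t - real j)" for t
  have h[measurable]: "h \<in> borel_measurable borel" unfolding h_def by measurable
  have h01: "0 \<le> h t" "h t \<le> 1/2" for t
    unfolding h_def by (rule tent_bounds)+
  have p: "0 < p" "p \<le> 1/64"
    using power_increasing[of 3 k "4::real"] k by (auto simp: p_def field_simps)
  have jp: "real j * p + p \<le> 1"
  proof -
    have "real (Suc j) \<le> real (4 ^ k)" unfolding of_nat_le_iff using j by simp
    then show ?thesis by (simp add: p_def field_simps)
  qed
  have le1: "norm (1 - cos (l * h t)) \<le> 2" "norm (cos (l * h t)) \<le> 1" "norm (sin (l * h t)) \<le> 1"
     "norm (cis (l * h t)) \<le> 1" for t
    using cos_ge_minus_one[of "l * h t"] by (auto simp: abs_le_iff)
  have int: "integrable unif (\<lambda>t. cos (l * h t))" "integrable unif (\<lambda>t. sin (l * h t))"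
      "integrable unif (\<lambda>t. cis (l * h t))"
    by (rule integrable_unif[OF _ le1(2)] integrable_unif[OF _ le1(3)] integrable_unif[OF _ le1(4)];
      (unfold cis_conv_exp)?, measurable)+
  have ind: "integrable unif (\<lambda>t. c * indicator {a..b} t)" for a b c :: real
    by (rule integrable_unif[of _ "\<bar>c\<bar>"]) (auto simp: indicator_def)
  note int' = ind Bochner_Integration.integrable_diff integrable_abs int U.integrable_const
  define d where "d = (\<integral>t. 1 - cos (l * h t) \<partial>unif)"
  define e where "e = (\<integral>t. sin (l * h t) \<partial>unif)"
  have "Re (tent_char k j l) = (\<integral>t. cos (l * h t) \<partial>unif)"
    unfolding tent_char_def h_def[symmetric] by (subst integral_Re[OF int(3), symmetric]) simp
  also have "\<dots> = 1 - d"
    unfolding d_def using int(1) by (simp add: U.prob_space)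
  finally have Re: "Re (tent_char k j l) = 1 - d" .
  have Im: "Im (tent_char k j l) = e"
    unfolding tent_char_def h_def[symmetric] e_def
    by (subst integral_Im[OF int(3), symmetric]) simp
  \<comment> \<open>On the middle half \<open>?J\<close> of the support the tent is at least
    \<open>1/4\<close>, so \<open>1 - cos\<close> is at least \<open>(l/4)^2 / 4 = l^2 / 64\<close>.
    Outside \<open>?I\<close> the tent vanishes.\<close>
  let ?J = "{(real j + 1/4) * p..(real j + 3/4) * p}" and ?I = "{real j * p..(real j + 1) * p}"
  have J: "measure unif ?J = p / 2"
    using p jp by (subst measure_unif_Icc) (auto simp: algebra_simps)
  have I: "measure unif ?I = p"
    using p jp by (subst measure_unif_Icc) (auto simp: algebra_simps)
  have "l\<^sup>2 / 64 * (p / 2) = (\<integral>t. l\<^sup>2 / 64 * indicator ?J t \<partial>unif)"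
    by (simp add: J del: measure_uniform_measure)
  also have "\<dots> \<le> d" unfolding d_def
  proof (intro integral_mono)
    fix t :: real
    show "l\<^sup>2 / 64 * indicator ?J t \<le> 1 - cos (l * h t)"
    proof (cases "t \<in> ?J")
      case True
      then have "1/4 \<le> 4 ^ k * t - real j" "4 ^ k * t - real j \<le> 3/4"
        by (auto simp: p_def field_simps)
      then have "1/4 \<le> h t" by (auto simp: h_def tent_def)
      then have "l * (1/4) \<le> l * h t" by (intro mult_left_mono l)
      then have "(l * (1/4))\<^sup>2 \<le> (l * h t)\<^sup>2" using l by (intro power_mono) auto
      moreover have "l * h t \<le> 1 * 1" using l h01[of t] by (intro mult_mono) auto
      then have "(l * h t)\<^sup>2 / 4 \<le> 1 - cos (l * h t)"
        using l h01 by (intro quadratic_le_one_minus_cos) auto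
      ultimately show ?thesis using True by (simp add: power_mult_distrib power2_eq_square)
    qed auto
  qed (rule int')+
  finally have d: "l\<^sup>2 * p / 128 \<le> d" by simp
  have d1: "d \<le> 1"
  proof -
    have "d \<le> (\<integral>t. 1 \<partial>unif)" unfolding d_def
    proof (intro integral_mono)
      fix t :: real
      have "l * h t \<le> 1 * (1/2)" using l h01[of t] by (intro mult_mono) auto
      then show "1 - cos (l * h t) \<le> 1"
        using one_minus_cos_le_abs[of "l * h t"] l h01[of t] by (auto simp: abs_mult)
    qed (rule int')+
    then show ?thesis by (simp add: U.prob_space)
  qed
  have "\<bar>e\<bar> \<le> (\<integral>t. \<bar>sin (l * h t)\<bar> \<partial>unif)"
    unfolding e_def by (rule integral_abs_bound)
  also have "\<dots> \<le> (\<integral>t. l / 2 * indicator ?I t \<partial>unif)"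
  proof (intro integral_mono)
    fix t :: real
    show "\<bar>sin (l * h t)\<bar> \<le> l / 2 * indicator ?I t"
    proof (cases "t \<in> ?I")
      case True
      have "\<bar>sin (l * h t)\<bar> \<le> \<bar>l * h t\<bar>" by (rule abs_sin_x_le_abs_x)
      also have "\<dots> \<le> l * (1/2)" using l mult_left_mono[OF h01(2)[of t] l(1)] h01(1)[of t] by simp
      finally show ?thesis using True by simp
    next
      case False
      then have "4 ^ k * t - real j \<le> 0 \<or> 1 \<le> 4 ^ k * t - real j"
        by (auto simp: p_def field_simps)
      then have "h t = 0" unfolding h_def by (rule tent_eq_0)
      then show ?thesis using False by simp
    qed
  qed (rule int')+
  also have "\<dots> = l / 2 * p"
    by (simp add: I del: measure_uniform_measure)
  finally have "\<bar>e\<bar>\<^sup>2 \<le> (l / 2 * p)\<^sup>2"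
    by (intro power_mono) auto
  also have "\<dots> = l\<^sup>2 * p / 4 * p"
    by (simp add: power2_eq_square)
  \<comment> \<open>The assumption \<open>3 \<le> k\<close> enters here through
    \<open>p \<le> 1/64\<close>: it makes \<open>e^2\<close> at most half of the lower bound for
    \<open>d\<close>.\<close>
  also have "\<dots> \<le> l\<^sup>2 * p / 4 * (1/64)"
    using p by (intro mult_left_mono) auto
  finally have e: "e\<^sup>2 \<le> l\<^sup>2 * p / 256" by simp
  have "0 \<le> d" using d p by (meson order_trans divide_nonneg_nonneg mult_nonneg_nonneg zero_le_power2 less_imp_le zero_le_numeral)
  then have "(1 - d)\<^sup>2 \<le> 1 - d"
    using d1 mult_right_mono[of "1 - d" 1 "1 - d"] by (simp add: power2_eq_square)
  with d e have "(cmod (tent_char k j l))\<^sup>2 \<le> 1 - l\<^sup>2 * p / 256"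
    unfolding cmod_power2 Re Im by simp
  then show ?thesis by (simp add: p_def)
qed

context uniform_samples
begin

lemma integrable_tent_discrepancy:
  "integrable M (\<lambda>\<omega>. tent_discrepancy n (\<lambda>i. X i \<omega>) (\<lambda>i. Y i \<omega>) k j)"
proof -
  have "\<bar>tent u\<bar> \<le> 1" for u using tent_bounds[of u] by auto
  then show ?thesis unfolding tent_discrepancy_def
    by (intro Bochner_Integration.integrable_sum Bochner_Integration.integrable_diff
      integrable_const_bound[of _ 1]) (auto intro: AE_I2)
qed

text \<open>The two samples enter with opposite signs, so the characteristic function is a product
  of \<open>n\<close> factors and their conjugates, which is real.\<close>

lemma expectation_cos_tent_discrepancy:
  "expectation (\<lambda>\<omega>. cos (l * tent_discrepancy n (\<lambda>i. X i \<omega>) (\<lambda>i. Y i \<omega>) k j))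
     = ((cmod (tent_char k j l))\<^sup>2) ^ n"
proof -
  define T where "T \<omega> = tent_discrepancy n (\<lambda>i. X i \<omega>) (\<lambda>i. Y i \<omega>) k j" for \<omega>
  let ?u = "\<lambda>t. cis (l * tent (4 ^ k * t - real j))"
  have [measurable]: "?u \<in> borel_measurable borel" "(\<lambda>t. cnj (?u t)) \<in> borel_measurable borel"
    by (simp_all only: cis_cnj, simp_all only: cis_conv_exp) measurable
  have cis_sum: "cis (\<Sum>i<n. f i) = (\<Prod>i<n. cis (f i))" for f
    by (induction n) (simp_all flip: cis_mult)
  have bound: "norm (?u t) \<le> 1" "norm (cnj (?u t)) \<le> 1" for t by auto
  have eq: "cis (l * T \<omega>) = (\<Prod>i<n. ?u (X i \<omega>)) * (\<Prod>i<n. cnj (?u (Y i \<omega>)))" for \<omega>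
    by (simp add: T_def tent_discrepancy_def cis_cnj sum_subtractf sum_distrib_left
      right_diff_distrib cis_mult sum_negf flip: cis_sum)
  have int: "integrable M (\<lambda>\<omega>. cis (l * T \<omega>))"
    unfolding eq by (rule integrable_prod_samples[OF _ bound(1) _ bound(2)]) measurable
  have "expectation (\<lambda>\<omega>. cis (l * T \<omega>)) = tent_char k j l ^ n * (\<integral>t. cnj (?u t) \<partial>unif) ^ n"
    unfolding eq tent_char_def by (rule expectation_prod_samples[OF _ bound(1) _ bound(2)]) measurable
  also have "(\<integral>t. cnj (?u t) \<partial>unif) = cnj (tent_char k j l)"
    unfolding tent_char_def by simp
  also have "tent_char k j l ^ n * cnj (tent_char k j l) ^ n = complex_of_real (((cmod (tent_char k j l))\<^sup>2) ^ n)"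
    by (subst of_real_power, subst complex_norm_square) (rule power_mult_distrib[symmetric])
  finally have "Re (expectation (\<lambda>\<omega>. cis (l * T \<omega>))) = ((cmod (tent_char k j l))\<^sup>2) ^ n"
    by simp
  moreover have "Re (expectation (\<lambda>\<omega>. cis (l * T \<omega>))) = expectation (\<lambda>\<omega>. cos (l * T \<omega>))"
    by (subst integral_Re[OF int, symmetric]) simp
  ultimately show ?thesis by (simp add: T_def)
qed

lemma expectation_abs_tent_discrepancy:
  assumes k: "3 \<le> k" "4 ^ k \<le> n" and j: "j < 4 ^ k"
  shows "(1 - exp (- 1 / 256)) * sqrt n / 2 ^ k
    \<le> expectation (\<lambda>\<omega>. \<bar>tent_discrepancy n (\<lambda>i. X i \<omega>) (\<lambda>i. Y i \<omega>) k j\<bar>)"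
proof -
  define T where "T \<omega> = tent_discrepancy n (\<lambda>i. X i \<omega>) (\<lambda>i. Y i \<omega>) k j" for \<omega>
  \<comment> \<open>The inverse of the typical size of \<open>T\<close>: with this \<open>l\<close>
    the bound \<open>(1 - l^2 / (256 * 4 ^ k)) ^ n\<close> becomes a constant. The assumption
    \<open>4 ^ k \<le> n\<close> ensures \<open>l \<le> 1\<close>.\<close>
  define l where "l = 2 ^ k / sqrt n"
  have n: "0 < real n" using k(2) by (metis gr0I less_le_not_le of_nat_0_less_iff zero_less_numeral zero_less_power)
  have "real (4 ^ k) \<le> real n" unfolding of_nat_le_iff using k by simp
  then have l2: "l\<^sup>2 = 4 ^ k / n" "l\<^sup>2 \<le> 1\<^sup>2"
    using n by (simp_all add: l_def power_divide power_mult[symmetric] mult.commute[of k 2] power_mult)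
  have l: "0 < l" "l \<le> 1"
    using n power2_le_imp_le[OF l2(2)] by (auto simp: l_def)
  have "((cmod (tent_char k j l))\<^sup>2) ^ n \<le> (1 - l\<^sup>2 / (256 * 4 ^ k)) ^ n"
    using l by (intro power_mono tent_char_bound k j) auto
  also have "1 - l\<^sup>2 / (256 * 4 ^ k) = 1 + (- 1 / 256) / n"
    by (simp add: l2(1))
  also have "(1 + (- 1 / 256) / n) ^ n \<le> exp ((- 1 / 256) / n) ^ n"
    using n by (intro power_mono exp_ge_add_one_self) (auto simp: field_simps)
  also have "\<dots> = exp (- 1 / 256)"
    using n by (simp flip: exp_of_nat_mult)
  finally have "1 - exp (- 1 / 256) \<le> 1 - expectation (\<lambda>\<omega>. cos (l * T \<omega>))"
    by (simp add: T_def expectation_cos_tent_discrepancy)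
  also have "\<dots> = expectation (\<lambda>\<omega>. 1 - cos (l * T \<omega>))"
  proof -
    have [measurable]: "T \<in> borel_measurable M"
      unfolding T_def using integrable_tent_discrepancy by (rule borel_measurable_integrable)
    have "integrable M (\<lambda>\<omega>. cos (l * T \<omega>))"
      by (rule integrable_const_bound[of _ 1]) auto
    then show ?thesis by (simp add: prob_space)
  qed
  also have "\<dots> \<le> expectation (\<lambda>\<omega>. l * \<bar>T \<omega>\<bar>)"
  proof (rule integral_mono_AE')
    show "integrable M (\<lambda>\<omega>. l * \<bar>T \<omega>\<bar>)"
      unfolding T_def by (intro integrable_mult_right integrable_abs integrable_tent_discrepancy)
    show "AE \<omega> in M. 1 - cos (l * T \<omega>) \<le> l * \<bar>T \<omega>\<bar>"
      using one_minus_cos_le_abs l by (intro AE_I2) (metis abs_mult abs_of_pos)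
    show "AE \<omega> in M. 0 \<le> l * \<bar>T \<omega>\<bar>"
      using l by simp
  qed
  also have "\<dots> = l * expectation (\<lambda>\<omega>. \<bar>T \<omega>\<bar>)"
    by simp
  finally show ?thesis
    using l n by (simp add: l_def T_def field_simps)
qed

text \<open>At scale \<open>k\<close> there are \<open>4 ^ k\<close> tents, each with mean
  discrepancy of order \<open>sqrt n / 2 ^ k\<close> and weight \<open>(1/2) ^ k\<close>, so every
  scale from \<open>3\<close> on contributes the same multiple of \<open>sqrt n\<close>.\<close>

lemma expected_boundary_matching_cost_ge:
  assumes "4 ^ L \<le> n"
  shows "(1 - exp (- 1 / 256)) / 3 * (real L - 3) * sqrt n \<le> expected_boundary_matching_cost M X Y n"
proof -
  define c :: real where "c = 1 - exp (- 1 / 256)"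
  define T where "T k j \<omega> = tent_discrepancy n (\<lambda>i. X i \<omega>) (\<lambda>i. Y i \<omega>) k j" for k j \<omega>
  have int: "integrable M (\<lambda>\<omega>. \<bar>T k j \<omega>\<bar>)" for k j
    unfolding T_def by (intro integrable_abs integrable_tent_discrepancy)
  \<comment> \<open>For \<open>L < 3\<close> the sum is empty and the left-hand side is
    nonpositive.\<close>
  have "c * (real L - 3) * sqrt n \<le> (\<Sum>k\<in>{3..<L}. c * sqrt n)"
    by (cases "3 \<le> L") (auto simp: c_def mult_nonpos_nonneg mult_nonneg_nonpos)
  also have "\<dots> \<le> (\<Sum>k\<in>{3..<L}. (1/2) ^ k * (\<Sum>j<4^k. expectation (\<lambda>\<omega>. \<bar>T k j \<omega>\<bar>)))"
  proof (rule sum_mono)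
    fix k assume k: "k \<in> {3..<L}"
    then have "4 ^ k \<le> n"
      by (intro order_trans[OF power_increasing assms]) auto
    with k have "(\<Sum>j<(4::nat)^k. c * sqrt n / 2 ^ k) \<le> (\<Sum>j<4^k. expectation (\<lambda>\<omega>. \<bar>T k j \<omega>\<bar>))"
      unfolding c_def T_def by (intro sum_mono expectation_abs_tent_discrepancy) auto
    then have "(1/2) ^ k * (4 ^ k * (c * sqrt n / 2 ^ k)) \<le> (1/2) ^ k * (\<Sum>j<4^k. expectation (\<lambda>\<omega>. \<bar>T k j \<omega>\<bar>))"
      by (intro mult_left_mono) auto
    moreover have "(1/2) ^ k * (4 ^ k * (c * sqrt n / 2 ^ k)) = c * sqrt n"
    proof -
      have "(4::real) ^ k = 2 ^ k * 2 ^ k" by (simp flip: power_mult_distrib)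
      then show ?thesis by (simp add: power_one_over)
    qed
    ultimately show "c * sqrt n \<le> (1/2) ^ k * (\<Sum>j<4^k. expectation (\<lambda>\<omega>. \<bar>T k j \<omega>\<bar>))"
      by simp
  qed
  also have "\<dots> \<le> (\<Sum>k<L. (1/2) ^ k * (\<Sum>j<4^k. expectation (\<lambda>\<omega>. \<bar>T k j \<omega>\<bar>)))"
    by (intro sum_mono2) (auto intro!: mult_nonneg_nonneg sum_nonneg)
  also have "\<dots> = expectation (\<lambda>\<omega>. \<Sum>k<L. (1/2) ^ k * (\<Sum>j<4^k. \<bar>T k j \<omega>\<bar>))"
    using int by (simp add: Bochner_Integration.integral_sum)
  also have "\<dots> \<le> expectation (\<lambda>\<omega>. 3 * boundary_matching_cost n (\<lambda>i. X i \<omega>) (\<lambda>i. Y i \<omega>))"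
    using int integrable_boundary_matching_cost unfolding T_def
    by (intro integral_mono Bochner_Integration.integrable_sum integrable_mult_right
      sum_tent_discrepancy_le_boundary_cost) auto
  also have "\<dots> = 3 * expected_boundary_matching_cost M X Y n"
    by (simp add: expected_boundary_matching_cost_def)
  finally show ?thesis by (simp add: c_def)
qed

end

section \<open>Limits and rescaling\<close>

context uniform_samples
begin

lemma eventually_boundary_cost_ge:
  "\<forall>\<^sub>F n in sequentially. (1 - exp (- 1 / 256)) / 3
     \<le> expected_boundary_matching_cost M X Y n / sqrt (real n * ln (real n))"
proof -
  define c :: real where "c = (1 - exp (- 1 / 256)) / 3"
  have c: "0 \<le> c" by (simp add: c_def)
  \<comment> \<open>The scales give order \<open>sqrt n * ln n\<close>; the factor
    \<open>ln n\<close> is weakened here to its square root. Of the constant \<open>4\<close>, three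
    units are the skipped scales and one is the rounding of \<open>L\<close>.\<close>
  have "\<forall>\<^sub>F n in sequentially. sqrt (ln (real n)) \<le> ln (real n) / ln 4 - 4"
    by real_asymp
  moreover have "\<forall>\<^sub>F n in sequentially. 2 \<le> n"
    by (rule eventually_ge_at_top)
  ultimately show ?thesis
  proof eventually_elim
    case (elim n)
    define L where "L = nat \<lfloor>log 4 (real n)\<rfloor>"
    have n: "1 < real n" using elim by simp
    then have log: "0 \<le> log 4 (real n)" by simp
    have L: "real L \<le> log 4 (real n)" "log 4 (real n) - 1 \<le> real L"
      using log unfolding L_def by linarith+
    have "4 ^ L \<le> real n"
      using L(1) n by (simp add: le_log_iff powr_realpow)
    then have "real (4 ^ L) \<le> real n" by simp
    then have "4 ^ L \<le> n" unfolding of_nat_le_iff .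
    from expected_boundary_matching_cost_ge[OF this]
    have "c * (real L - 3) * sqrt n \<le> expected_boundary_matching_cost M X Y n"
      by (simp add: c_def)
    moreover have "sqrt (ln (real n)) \<le> real L - 3"
      using elim(1) L(2) unfolding log_def by linarith
    then have "c * (sqrt (ln (real n)) * sqrt n) \<le> c * ((real L - 3) * sqrt n)"
      using c by (intro mult_left_mono mult_right_mono) auto
    ultimately have "c * sqrt (real n * ln (real n)) \<le> expected_boundary_matching_cost M X Y n"
      by (simp add: real_sqrt_mult mult.assoc mult.commute[of "sqrt (real n)"])
    then have "c \<le> expected_boundary_matching_cost M X Y n / sqrt (real n * ln (real n))"
      using n by (simp add: pos_le_divide_eq)
    then show ?case by (simp only: c_def)
  qed
qed

lemma boundary_cost_difference_tendsto:
  "(\<lambda>n. (expected_boundary_matching_cost M X Y n - expected_matching_cost M X Y n)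
     / sqrt (real n * ln (real n))) \<longlonglongrightarrow> 0"
proof (rule tendstoI)
  fix \<epsilon> :: real assume \<epsilon>: "0 < \<epsilon>"
  \<comment> \<open>\<open>N\<close> is fixed before \<open>n\<close> grows. The normalised error
    tends to \<open>6 / sqrt N\<close>, and this choice gives
    \<open>7 / sqrt N < \<epsilon>\<close>.\<close>
  obtain N :: nat where N: "(7 / \<epsilon>)\<^sup>2 < real N"
    using reals_Archimedean2 by blast
  then have N0: "0 < N"
    using zero_le_power2[of "7 / \<epsilon>"] by (metis of_nat_0_less_iff le_less_trans)
  define D where "D = sqrt (real N)"
  define C where "C = ln (real N) + 3"
  have D: "0 < D" "D\<^sup>2 = real N" using N0 by (auto simp: D_def)
  have "7 / \<epsilon> < D"
    using N \<epsilon> by (auto simp: D_def intro: real_less_rsqrt)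
  then have "6 / D < \<epsilon>"
    using D \<epsilon> by (simp add: field_simps)
  moreover have "(\<lambda>n. 2 * (C / sqrt (ln (real n)) + (3 + C / ln (real n)) / D)) \<longlonglongrightarrow> 2 * (0 + (3 + 0) / D)"
    by (intro tendsto_intros; (use D in simp)?; real_asymp)
  ultimately have "\<forall>\<^sub>F n in sequentially.
      2 * (C / sqrt (ln (real n)) + (3 + C / ln (real n)) / D) < \<epsilon>"
    by (intro order_tendstoD(2)) auto
  moreover have "\<forall>\<^sub>F n in sequentially. D * sqrt (ln (real n) / real n) \<le> 1"
    by real_asymp
  moreover have "\<forall>\<^sub>F n in sequentially. 2 \<le> n"
    by (rule eventually_ge_at_top)
  ultimately show "\<forall>\<^sub>F n in sequentially. dist ((expected_boundary_matching_cost M X Y n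
      - expected_matching_cost M X Y n) / sqrt (real n * ln (real n))) 0 < \<epsilon>"
  proof eventually_elim
    case (elim n)
    define s where "s = sqrt (real n)"
    define w where "w = sqrt (ln (real n))"
    have n: "1 < real n" using elim by simp
    then have s: "1 < s" "s\<^sup>2 = real n" and w: "0 < w" "w\<^sup>2 = ln (real n)"
      by (auto simp: s_def w_def)
    \<comment> \<open>\<open>l1\<close> makes \<open>n * l1^2\<close> equal to \<open>1\<close>, so
      the coarse part is of order \<open>sqrt n\<close>. \<open>l2\<close> makes
      \<open>n * l2^2 / N\<close> equal to \<open>ln n\<close>, balancing it against the logarithm
      of the number of fine cells.\<close>
    define l1 where "l1 = 1 / s"
    define l2 where "l2 = D * w / s"
    have l1: "0 < l1" "l1 \<le> 1" using s by (auto simp: l1_def)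
    have l2: "0 < l2" "l2 \<le> 1" using s w D elim(2)
      by (auto simp: l2_def s_def w_def real_sqrt_divide)
    have eq: "real n * l1\<^sup>2 = 1" "real n * l2\<^sup>2 / real N = w\<^sup>2"
      using s w D by (simp_all add: l1_def l2_def power_divide power_mult_distrib flip: s(2) D(2))
    have "expected_matching_cost M X Y n - expected_boundary_matching_cost M X Y n
        \<le> 2 * ((ln (real N) + 2 * (real n * l1\<^sup>2) + 1) / l1
          + (ln (real n) + ln (real N) + 2 * (real n * l2\<^sup>2 / real N) + 3) / l2)"
      using expected_matching_le_boundary[OF _ N0 l1 l2, of n] n by (simp add: mult.assoc)
    also have "\<dots> = 2 * (C / l1 + (3 * w\<^sup>2 + C) / l2)"
      unfolding eq w(2) C_def by (simp add: algebra_simps)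
    also have "\<dots> = 2 * (C / w + (3 + C / w\<^sup>2) / D) * (s * w)"
      using s(1) w(1) D(1) by (simp add: l1_def l2_def field_simps power2_eq_square)
    also have "\<dots> < \<epsilon> * (s * w)"
      using elim(1) s w by (intro mult_strict_right_mono) (auto simp: w_def)
    finally have "expected_matching_cost M X Y n - expected_boundary_matching_cost M X Y n < \<epsilon> * (s * w)" .
    moreover have "sqrt (real n * ln (real n)) = s * w"
      by (simp add: s_def w_def real_sqrt_mult)
    moreover have "0 < s * w" using s w by simp
    ultimately show ?case
      using expected_boundary_le_matching[of n]
      by (simp add: abs_div abs_minus_commute pos_divide_less_eq)
  qed
qed

end

section \<open>Transfer from the unit interval to bounded intervals\<close>

lemma uniform_samplesI:
  "indep_uniform_samples M {0..1} X Y \<Longrightarrow> uniform_samples M X Y"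
  by (simp add: indep_uniform_samples_def uniform_samples_def uniform_samples_axioms_def)

lemma matching_cost_affine:
  assumes "0 \<le> c"
  shows "matching_cost n (\<lambda>i. c * x i + d) (\<lambda>i. c * y i + d) = sqrt c * matching_cost n x y"
proof -
  let ?S = "{\<sigma>. \<sigma> permutes {..<n}}"
  let ?F = "\<lambda>\<sigma>. \<Sum>i<n. \<bar>x i - y (\<sigma> i)\<bar> powr (1/2)"
  have "(\<Sum>i<n. \<bar>c * x i + d - (c * y (\<sigma> i) + d)\<bar> powr (1/2)) = sqrt c * ?F \<sigma>" for \<sigma>
    using assms by (simp add: sum_distrib_left powr_half_sqrt abs_mult real_sqrt_mult
      flip: right_diff_distrib)
  then have "matching_cost n (\<lambda>i. c * x i + d) (\<lambda>i. c * y i + d) = Min ((*) (sqrt c) ` ?F ` ?S)"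
    by (simp add: matching_cost_def image_image)
  also have "\<dots> = sqrt c * Min (?F ` ?S)"
  proof (rule mono_Min_commute[symmetric])
    show "mono ((*) (sqrt c))"
      using assms by (intro monoI mult_left_mono) auto
    show "?F ` ?S \<noteq> {}"
      using permutes_id by blast
  qed (simp add: finite_permutations)
  finally show ?thesis by (simp add: matching_cost_def)
qed

lemma bounded_interval_endpoints:
  fixes I :: "real set"
  assumes I: "is_interval I" "bounded I" "0 < measure lborel I"
  obtains a b where "a < b" "{a<..<b} \<subseteq> I" "I \<subseteq> {a..b}"
proof -
  define a b where "a = Inf I" and "b = Sup I"
  have ne: "I \<noteq> {}" using I by auto
  have bdd: "bdd_below I" "bdd_above I"
    using \<open>bounded I\<close> by (auto intro: bounded_imp_bdd_below bounded_imp_bdd_above)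
  have sub: "I \<subseteq> {a..b}"
    using bdd by (auto simp: a_def b_def intro: cInf_lower cSup_upper)
  have sup: "{a<..<b} \<subseteq> I"
  proof
    fix t assume "t \<in> {a<..<b}"
    then obtain x y where "x \<in> I" "x < t" "y \<in> I" "t < y"
      using cInf_lessD[OF ne] less_cSupD[OF ne] by (metis a_def b_def greaterThanLessThan_iff)
    then show "t \<in> I"
      using mem_is_interval_1_I[OF I(1)] by (meson less_imp_le)
  qed
  have "a < b"
  proof (rule ccontr)
    assume "\<not> a < b"
    then have "I \<subseteq> {a}" using sub by auto
    then have "I = {a}" using ne by auto
    then show False using I(3) by simp
  qed
  then show thesis using sup sub by (rule that)
qed

text \<open>\<open>I\<close> and \<open>{a..b}\<close> differ only by endpoints, a null set, so the
  distribution functions can be computed on \<open>{a..b}\<close> and compared.\<close>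

lemma distr_uniform_interval:
  fixes I :: "real set"
  assumes ab: "a < b" "{a<..<b} \<subseteq> I" "I \<subseteq> {a..b}"
  shows "distr (uniform_measure lborel I) borel (\<lambda>t. (t - a) / (b - a)) = unif"
proof -
  \<comment> \<open>An open interval plus at most two points: this gives the measurability of
    \<open>I\<close>.\<close>
  have "I = {a<..<b} \<union> (I \<inter> {a, b})"
    using ab by auto
  moreover have "{a<..<b} \<union> (I \<inter> {a, b}) \<in> sets borel"
    by (intro sets.Un borel_open open_greaterThanLessThan borel_closed finite_imp_closed) auto
  ultimately have [measurable]: "I \<in> sets borel" by simp
  have AE: "AE t in lborel. t \<in> I \<longleftrightarrow> t \<in> {a..b}"
    using AE_lborel_singleton[of a] AE_lborel_singleton[of b]
    by eventually_elim (use ab in \<open>auto simp: subset_iff\<close>)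
  have meas: "measure lborel (I \<inter> S) = measure lborel ({a..b} \<inter> S)" if [measurable]: "S \<in> sets borel" for S
    using AE by (intro measure_eq_AE) auto
  have emI: "emeasure lborel I = ennreal (b - a)"
    using ab AE by (subst emeasure_eq_AE[of I "{a..b}"]) auto
  then have mI: "measure lborel I = b - a"
    using ab by (simp add: measure_def)
  interpret U: prob_space "uniform_measure lborel I"
    by (rule prob_space_uniform_measure) (use emI ab in auto)
  have Icc: "measure lborel {l..u} = max 0 (u - l)" for l u :: real
    by (cases "l \<le> u") auto
  let ?g = "\<lambda>t. (t - a) / (b - a)"
  show ?thesis
  proof (rule cdf_unique)
    have "prob_space (distr (uniform_measure lborel I) borel ?g)"
      by (rule U.prob_space_distr) simp
    then show "real_distribution (distr (uniform_measure lborel I) borel ?g)"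
      by (simp add: real_distribution_def real_distribution_axioms_def)
    show "real_distribution unif"
      using prob_space_unif by (simp add: real_distribution_def real_distribution_axioms_def)
    show "cdf (distr (uniform_measure lborel I) borel ?g) = cdf unif"
    proof
      fix t
      have "cdf (distr (uniform_measure lborel I) borel ?g) t
          = measure (uniform_measure lborel I) {..a + (b - a) * t}"
        unfolding cdf_def using ab
        by (subst measure_distr) (auto intro!: arg_cong[where f = "measure _"] simp: field_simps)
      also have "\<dots> = measure lborel ({a..b} \<inter> {..a + (b - a) * t}) / (b - a)"
        using ab emI mI by (subst measure_uniform_measure) (simp_all add: meas)
      also have "{a..b} \<inter> {..a + (b - a) * t} = {a..min b (a + (b - a) * t)}"
        by auto
      also have "measure lborel \<dots> = (b - a) * max 0 (min 1 t)"
      proof -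
        have "min b (a + (b - a) * t) - a = (b - a) * min 1 t"
          using ab by (simp add: min_mult_distrib_left min_diff_distrib_left)
        then show ?thesis
          using ab by (simp add: Icc max_mult_distrib_left)
      qed
      also have "(b - a) * max 0 (min 1 t) / (b - a) = max 0 (min 1 t)"
        using ab by simp
      also have "\<dots> = measure lborel {0..min 1 t}"
        by (simp add: Icc)
      also have "{0..min 1 t} = {0..1} \<inter> {..t}" by auto
      also have "measure lborel \<dots> = cdf unif t"
        by (simp add: cdf_def)
      finally show "cdf (distr (uniform_measure lborel I) borel ?g) t = cdf unif t" .
    qed
  qed
qed

lemma uniform_samples_rescale:
  fixes I :: "real set"
  assumes ab: "a < b" "{a<..<b} \<subseteq> I" "I \<subseteq> {a..b}" and XY: "indep_uniform_samples N I X Y"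
  shows "uniform_samples N (\<lambda>i \<omega>. (X i \<omega> - a) / (b - a)) (\<lambda>i \<omega>. (Y i \<omega> - a) / (b - a))"
proof -
  interpret prob_space N
    using XY by (simp add: indep_uniform_samples_def)
  have ind: "indep_vars (\<lambda>_. borel) (case_sum X Y) UNIV"
    and dX: "\<And>i. distr N borel (X i) = uniform_measure lborel I"
    and dY: "\<And>i. distr N borel (Y i) = uniform_measure lborel I"
    using XY by (auto simp: indep_uniform_samples_def)
  let ?g = "\<lambda>t. (t - a) / (b - a)"
  have [measurable]: "X i \<in> borel_measurable N" "Y i \<in> borel_measurable N" for i
    using ind[unfolded indep_vars_def, THEN conjunct1, THEN bspec[of _ _ "Inl i"]]
      ind[unfolded indep_vars_def, THEN conjunct1, THEN bspec[of _ _ "Inr i"]] by simp_all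
  have "indep_vars (\<lambda>_. borel) (\<lambda>s \<omega>. ?g (case_sum X Y s \<omega>)) UNIV"
    by (rule indep_vars_compose2[OF ind]) simp
  moreover have "(\<lambda>s \<omega>. ?g (case_sum X Y s \<omega>)) = case_sum (\<lambda>i \<omega>. ?g (X i \<omega>)) (\<lambda>i \<omega>. ?g (Y i \<omega>))"
    by (auto simp: fun_eq_iff split: sum.split)
  moreover have "distr N borel (\<lambda>\<omega>. ?g (X i \<omega>)) = unif" for i
    using distr_distr[of ?g borel borel "X i" N]
    by (simp add: comp_def dX distr_uniform_interval[OF ab])
  moreover have "distr N borel (\<lambda>\<omega>. ?g (Y i \<omega>)) = unif" for i
    using distr_distr[of ?g borel borel "Y i" N]
    by (simp add: comp_def dY distr_uniform_interval[OF ab])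
  ultimately show ?thesis
    by unfold_locales simp_all
qed

lemma liminf_pos:
  assumes "\<forall>\<^sub>F n in sequentially. c \<le> f n" "0 < (c :: real)"
  shows "0 < liminf (\<lambda>n. ereal (f n))"
proof -
  have "ereal c \<le> liminf (\<lambda>n. ereal (f n))"
    by (rule Liminf_bounded) (use assms(1) in simp)
  with assms(2) show ?thesis
    by (metis ereal_less(2) less_le_trans)
qed

lemma one_minus_exp_const_pos: "0 < (1 - exp (- 1 / 256)) / (3::real)"
  by simp

text \<open>Rescaling to the unit interval divides the cost by \<open>sqrt (b - a)\<close>, and
  there the matching cost dominates the boundary cost, whose lower bound applies.\<close>

lemma liminf_matching_cost_interval:
  assumes I: "is_interval I" "bounded I" "0 < measure lborel I" and XY: "indep_uniform_samples N I X Y"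
  shows "0 < liminf (\<lambda>n. ereal (expected_matching_cost N X Y n / sqrt (real n * ln (real n))))"
proof -
  obtain a b where ab: "a < b" "{a<..<b} \<subseteq> I" "I \<subseteq> {a..b}"
    using bounded_interval_endpoints[OF I] .
  interpret uniform_samples N "\<lambda>i \<omega>. (X i \<omega> - a) / (b - a)" "\<lambda>i \<omega>. (Y i \<omega> - a) / (b - a)"
    by (rule uniform_samples_rescale[OF ab XY])
  let ?X = "\<lambda>i \<omega>. (X i \<omega> - a) / (b - a)" and ?Y = "\<lambda>i \<omega>. (Y i \<omega> - a) / (b - a)"
  let ?c = "(1 - exp (- 1 / 256)) / (3::real)"
  have "matching_cost n (\<lambda>i. X i \<omega>) (\<lambda>i. Y i \<omega>)
      = sqrt (b - a) * matching_cost n (\<lambda>i. ?X i \<omega>) (\<lambda>i. ?Y i \<omega>)" for n \<omega>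
    using matching_cost_affine[of "b - a" n "\<lambda>i. ?X i \<omega>" a "\<lambda>i. ?Y i \<omega>"] ab by simp
  then have scale: "expected_matching_cost N X Y n = sqrt (b - a) * expected_matching_cost N ?X ?Y n" for n
    by (simp add: expected_matching_cost_def)
  have "\<forall>\<^sub>F n in sequentially. sqrt (b - a) * ?c
      \<le> expected_matching_cost N X Y n / sqrt (real n * ln (real n))"
    using eventually_boundary_cost_ge eventually_ge_at_top[of 1]
  proof eventually_elim
    case (elim n)
    have "?c \<le> expected_matching_cost N ?X ?Y n / sqrt (real n * ln (real n))"
      using elim expected_boundary_le_matching[of n]
      by (intro order_trans[OF elim(1)] divide_right_mono) auto
    then have "sqrt (b - a) * ?c
        \<le> sqrt (b - a) * (expected_matching_cost N ?X ?Y n / sqrt (real n * ln (real n)))"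
      using ab by (intro mult_left_mono) auto
    then show ?case by (simp add: scale)
  qed
  then show ?thesis
    by (rule liminf_pos) (use ab one_minus_exp_const_pos in simp)
qed

theorem mainTheorem4:
  shows
    "(\<forall>(M :: 'a measure) X Y. indep_uniform_samples M {0..1} X Y \<longrightarrow>
        (\<lambda>n. (expected_boundary_matching_cost M X Y n - expected_matching_cost M X Y n)
               / sqrt (real n * ln (real n))) \<longlonglongrightarrow> 0 \<and>
        liminf (\<lambda>n. ereal (expected_boundary_matching_cost M X Y n
                             / sqrt (real n * ln (real n)))) > 0) \<and>
     (\<forall>(N :: 'b measure) I X Y.
        is_interval I \<and> bounded I \<and> measure lborel I > 0 \<and>
        indep_uniform_samples N I X Y \<longrightarrow>
        liminf (\<lambda>n. ereal (expected_matching_cost N X Y n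
                             / sqrt (real n * ln (real n)))) > 0)"
proof (intro conjI allI impI)
  fix M :: "'a measure" and X Y
  assume "indep_uniform_samples M {0..1} X Y"
  then interpret uniform_samples M X Y by (rule uniform_samplesI)
  show "(\<lambda>n. (expected_boundary_matching_cost M X Y n - expected_matching_cost M X Y n)
      / sqrt (real n * ln (real n))) \<longlonglongrightarrow> 0"
    by (rule boundary_cost_difference_tendsto)
  show "0 < liminf (\<lambda>n. ereal (expected_boundary_matching_cost M X Y n / sqrt (real n * ln (real n))))"
    by (rule liminf_pos[OF eventually_boundary_cost_ge one_minus_exp_const_pos])
next
  fix N :: "'b measure" and I X Y
  assume "is_interval I \<and> bounded I \<and> measure lborel I > 0 \<and> indep_uniform_samples N I X Y"
  then show "0 < liminf (\<lambda>n. ereal (expected_matching_cost N X Y n / sqrt (real n * ln (real n))))"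
    by (intro liminf_matching_cost_interval) auto
qed

end
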